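(* Let $K$ be a field and let $\psi\colon D\to E$ be a morphism of dialgebras over $K$. If the group $HY^3(\psi,\psi)$ is trivial, then every $2$-cocycle in $CY^2(\psi,\psi)$ is the infinitesimal of some deformation of $\psi$.
   Context: **Dialgebras.** All tensor products and $\mathrm{Hom}$'s are over the field $K$. A dialgebra over $K$ is a $K$-module $D$ with two $K$-bilinear maps $\dashv,\vdash\colon D\otimes D\to D$ (left and right product) such that for all $x,y,z$: (1) $x\dashv(y\dashv z)=(x\dashv y)\dashv z$; (2) $(x\dashv y)\dashv z=x\dashv(y\vdash z)$; (3) $(x\vdash y)\dashv z=x\vdash(y\dashv z)$; (4) $(x\dashv y)\vdash z=x\vdash(y\vdash z)$; (5) $x\vdash(y\vdash z)=(x\vdash y)\vdash z$. A morphism of dialgebras is a $K$-linear map preserving both products. A representation of $D$ is a $K$-module $M$ with left actions $\dashv,\vdash\colon D\otimes M\to M$ and right actions $\dashv,\vdash\colon M\otimes D\to M$ satisfying the fifteen identities obtained from (1)–(5) by letting exactly one of $x,y,z$ lie in $M$. $D$ is a representation of itself; given a morphism $\psi\colon D\to E$, $E$ is a representation of $D$ via $a* e=\psi(a)* e$, $e* a=e*\psi(a)$ for $*\in\{\dashv,\vdash\}$. **Trees.** $Y_n$ is the set of planar binary trees with $n+1$ leaves, numbered $0,\dots,n$ from left to right ("$n$-trees"); $Y_0=\{|\}$, and every $y\in Y_n$ with $n\ge1$ is uniquely a grafting $y=y_1\vee y_2$ (left subtree $y_1$, right subtree $y_2$). The two $2$-trees are $[21]=|\vee(|\vee|)$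 and $[12]=(|\vee|)\vee|$. For $y\in Y_n$, $n\ge1$, $d_iy\in Y_{n-1}$ is obtained by deleting the $i$th leaf. For $y\in Y_{n+1}$ define $\circ^y_i\in\{\dashv,\vdash\}$, $0\le i\le n+1$: $\circ^y_0=\dashv$ if $y=|\vee y_1$ for some $y_1$, and $\vdash$ otherwise; for $1\le i\le n$, $\circ^y_i=\dashv$ if the $i$th leaf is the left branch at its vertex, and $\vdash$ if it is the right branch; $\circ^y_{n+1}=\vdash$ if $y=y_1\vee|$ for some $y_1$, and $\dashv$ otherwise. **Dialgebra cochains.** For a representation $M$ of $D$, $CY^n(D,M)=\mathrm{Hom}(K[Y_n]\otimes D^{\otimes n},M)$ for $n\ge0$, and $\delta=\sum_{i=0}^{n+1}(-1)^i\delta^i\colon CY^n(D,M)\to CY^{n+1}(D,M)$, where $(\delta^if)(y\otimes(a_1,\dots,a_{n+1}))$ equals $a_1\circ^y_0f(d_0y\otimes(a_2,\dots,a_{n+1}))$ if $i=0$; $f(d_iy\otimes(\dots,a_{i-1},a_i\circ^y_ia_{i+1},a_{i+2},\dots))$ if $1\le i\le n$; and $f(d_{n+1}y\otimes(a_1,\dots,a_n))\circ^y_{n+1}a_{n+1}$ if $i=n+1$. **Deformation complex.** For $n\ge1$ put $CY^n(\psi,\psi)=CY^n(D,D)\times CY^n(E,E)\times CY^{n-1}(D,E)$ and $\delta(\xi;\pi;\varphi)=(\delta\xi;\ \delta\pi;\ \psi\xi-\pi\psi-\delta\varphi)\in CY^{n+1}(\psi,\psi)$, where $(\psi\xi)(y\otimes(a_1,\dots,a_n))=\psi(\xi(y\otimes(a_1,\dots,a_n)))$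 and $(\pi\psi)(y\otimes(a_1,\dots,a_n))=\pi(y\otimes(\psi(a_1),\dots,\psi(a_n)))$. This is a cochain complex, and $HY^3(\psi,\psi)=H^3(CY^*(\psi,\psi),\delta)$. **Deformations.** A deformation of a dialgebra $D$ is a pair of power series $f_t=(f^l_t=\sum_{n\ge0}F^l_nt^n;\ f^r_t=\sum_{n\ge0}F^r_nt^n)$ with each $F^l_n,F^r_n\colon D\otimes D\to D$ $K$-bilinear, $F^l_0=\dashv$, $F^r_0=\vdash$, such that $D[[t]]$ with left product $f^l_t$ and right product $f^r_t$ (extended to power series, i.e. $f^*_t(\sum a_it^i,\sum b_jt^j)=\sum F^*_n(a_i,b_j)t^{n+i+j}$) is a dialgebra, denoted $D_t$. The pair $(F^l_n;F^r_n)$ is identified with the cochain $F_n\in CY^2(D,D)$, $F_n([21]\otimes(a,b))=F^l_n(a,b)$, $F_n([12]\otimes(a,b))=F^r_n(a,b)$, and one writes $f_t=\sum F_nt^n$. A deformation of $\psi\colon D\to E$ is a triple $\Theta_t=(f_{D,t};f_{E,t};\Psi_t)$ where $f_{D,t}=\sum F_{D,n}t^n$ and $f_{E,t}=\sum F_{E,n}t^n$ are deformations of $D$ and $E$, and $\Psi_t=\sum_{n\ge0}\psi_nt^n\colon D_t\to E_t$ is a dialgebra morphism with each $\psi_n\colon D\to E$ $K$-linear and $\psi_0=\psi$. Since there is only one $1$-tree, $\psi_n\in CY^1(D,E)$, and one writes $\theta_n=(F_{D,n};F_{E,n};\psi_n)\in CY^2(\psi,\psi)$ and $\Theta_t=\sum\theta_nt^n$.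 The infinitesimal of $\Theta_t$ is $\theta_1$. *)

theory Defs
  imports
    "HOL-Library.Function_Algebras"
    "HOL-Library.Product_Plus"
    "HOL-Computational_Algebra.Formal_Power_Series"
    "HOL-Algebra.Elementary_Groups"
begin

section \<open>Dialgebras, morphisms, representations\<close>

record ('k, 'a) dialg =
  smul :: "'k \<Rightarrow> 'a \<Rightarrow> 'a"
  lprod :: "'a \<Rightarrow> 'a \<Rightarrow> 'a" (infixl "\<stileturn>\<index>" 70)
  rprod :: "'a \<Rightarrow> 'a \<Rightarrow> 'a" (infixl "\<turnstile>\<index>" 70)

definition bilin ::
  "('k::field \<Rightarrow> 'a::ab_group_add \<Rightarrow> 'a) \<Rightarrow> ('k \<Rightarrow> 'b::ab_group_add \<Rightarrow> 'b) \<Rightarrow>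
   ('k \<Rightarrow> 'c::ab_group_add \<Rightarrow> 'c) \<Rightarrow> ('a \<Rightarrow> 'b \<Rightarrow> 'c) \<Rightarrow> bool"
  where "bilin s1 s2 s3 f \<longleftrightarrow>
    (\<forall>a. Vector_Spaces.linear s2 s3 (\<lambda>b. f a b)) \<and> (\<forall>b. Vector_Spaces.linear s1 s3 (\<lambda>a. f a b))"

locale dialgebra =
  fixes D :: "('k::field, 'a::ab_group_add) dialg" (structure)
  assumes vs: "vector_space (smul D)"
    and lprod_bilin: "bilin (smul D) (smul D) (smul D) (lprod D)"
    and rprod_bilin: "bilin (smul D) (smul D) (smul D) (rprod D)"
    and ax1: "x \<stileturn> (y \<stileturn> z) = (x \<stileturn> y) \<stileturn> z"
    and ax2: "(x \<stileturn> y) \<stileturn> z = x \<stileturn> (y \<turnstile> z)"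
    and ax3: "(x \<turnstile> y) \<stileturn> z = x \<turnstile> (y \<stileturn> z)"
    and ax4: "(x \<stileturn> y) \<turnstile> z = x \<turnstile> (y \<turnstile> z)"
    and ax5: "x \<turnstile> (y \<turnstile> z) = (x \<turnstile> y) \<turnstile> z"

locale dialgebra_morphism = D: dialgebra D + E: dialgebra E
  for D :: "('k::field, 'd::ab_group_add) dialg"
    and E :: "('k, 'e::ab_group_add) dialg" +
  fixes \<psi> :: "'d \<Rightarrow> 'e"
  assumes lin: "Vector_Spaces.linear (smul D) (smul E) \<psi>"
    and hom_lprod: "\<psi> (x \<stileturn>\<^bsub>D\<^esub> y) = \<psi> x \<stileturn>\<^bsub>E\<^esub> \<psi> y"
    and hom_rprod: "\<psi> (x \<turnstile>\<^bsub>D\<^esub> y) = \<psi> x \<turnstile>\<^bsub>E\<^esub> \<psi> y"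

text \<open>The two symbols \<open>\<stileturn>\<close> (\<open>Lft\<close>) and \<open>\<turnstile>\<close> (\<open>Rgt\<close>), used to index products and actions.\<close>

datatype side = Lft | Rgt

definition dprod :: "('k, 'a) dialg \<Rightarrow> side \<Rightarrow> 'a \<Rightarrow> 'a \<Rightarrow> 'a"
  where "dprod D s = (case s of Lft \<Rightarrow> lprod D | Rgt \<Rightarrow> rprod D)"

record ('k, 'd, 'm) rep =
  msmul :: "'k \<Rightarrow> 'm \<Rightarrow> 'm"
  lact :: "side \<Rightarrow> 'd \<Rightarrow> 'm \<Rightarrow> 'm"
  ract :: "side \<Rightarrow> 'm \<Rightarrow> 'd \<Rightarrow> 'm"

text \<open>In the names of the identities the suffix tells which of \<open>x, y, z\<close> is in the module.\<close>

locale representation = D: dialgebra D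
  for D :: "('k::field, 'd::ab_group_add) dialg" (structure) +
  fixes M :: "('k, 'd, 'm::ab_group_add) rep"
  assumes mvs: "vector_space (msmul M)"
    and lact_bilin: "bilin (smul D) (msmul M) (msmul M) (lact M s)"
    and ract_bilin: "bilin (msmul M) (smul D) (msmul M) (ract M s)"
    and r1x: "ract M Lft m (y \<stileturn> z) = ract M Lft (ract M Lft m y) z"
    and r1y: "lact M Lft x (ract M Lft m z) = ract M Lft (lact M Lft x m) z"
    and r1z: "lact M Lft x (lact M Lft y m) = lact M Lft (x \<stileturn> y) m"
    and r2x: "ract M Lft (ract M Lft m y) z = ract M Lft m (y \<turnstile> z)"
    and r2y: "ract M Lft (lact M Lft x m) z = lact M Lft x (ract M Rgt m z)"
    and r2z: "lact M Lft (x \<stileturn> y) m = lact M Lft x (lact M Rgt y m)"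
    and r3x: "ract M Lft (ract M Rgt m y) z = ract M Rgt m (y \<stileturn> z)"
    and r3y: "ract M Lft (lact M Rgt x m) z = lact M Rgt x (ract M Lft m z)"
    and r3z: "lact M Lft (x \<turnstile> y) m = lact M Rgt x (lact M Lft y m)"
    and r4x: "ract M Rgt (ract M Lft m y) z = ract M Rgt m (y \<turnstile> z)"
    and r4y: "ract M Rgt (lact M Lft x m) z = lact M Rgt x (ract M Rgt m z)"
    and r4z: "lact M Rgt (x \<stileturn> y) m = lact M Rgt x (lact M Rgt y m)"
    and r5x: "ract M Rgt m (y \<turnstile> z) = ract M Rgt (ract M Rgt m y) z"
    and r5y: "lact M Rgt x (ract M Rgt m z) = ract M Rgt (lact M Rgt x m) z"
    and r5z: "lact M Rgt x (lact M Rgt y m) = lact M Rgt (x \<turnstile> y) m"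

definition rep_via :: "('d \<Rightarrow> 'e) \<Rightarrow> ('k, 'e) dialg \<Rightarrow> ('k, 'd, 'e) rep"
  where "rep_via \<psi> E =
    \<lparr>msmul = smul E, lact = (\<lambda>s a e. dprod E s (\<psi> a) e), ract = (\<lambda>s e a. dprod E s e (\<psi> a))\<rparr>"

definition self_rep :: "('k, 'd) dialg \<Rightarrow> ('k, 'd, 'd) rep"
  where "self_rep D = \<lparr>msmul = smul D, lact = dprod D, ract = dprod D\<rparr>"

lemma (in dialgebra_morphism) representation_rep_via: "representation D (rep_via \<psi> E)"
proof -
  have "bilin (smul E) (smul E) (smul E) (dprod E s)" for s
    using E.lprod_bilin E.rprod_bilin by (cases s) (simp_all add: dprod_def)
  then have l: "Vector_Spaces.linear (smul E) (smul E) (dprod E s a)"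
    and r: "Vector_Spaces.linear (smul E) (smul E) (\<lambda>a. dprod E s a b)" for s a b
    by (simp_all add: bilin_def)
  have "Vector_Spaces.linear (smul D) (smul E) (\<lambda>a. dprod E s e (\<psi> a))"
    and "Vector_Spaces.linear (smul D) (smul E) (\<lambda>a. dprod E s (\<psi> a) e)" for s e
    using Vector_Spaces.linear_compose[OF lin l[of s e]]
      Vector_Spaces.linear_compose[OF lin r[of s e]] by (simp_all add: o_def)
  with l r show ?thesis
    by (intro representation.intro representation_axioms.intro D.dialgebra_axioms)
      (simp_all add: rep_via_def bilin_def E.vs,
       simp_all add: dprod_def hom_lprod hom_rprod E.ax1 E.ax2 E.ax3 E.ax4 E.ax5)
qed

lemma (in dialgebra) self_rep_eq: "self_rep D = rep_via id D"
  by (simp add: self_rep_def rep_via_def)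


section \<open>Planar binary trees\<close>

datatype tree = Leaf | Graft tree tree (infix "\<or>\<^sub>t" 65)

fun leaves :: "tree \<Rightarrow> nat" where
  "leaves Leaf = 1"
| "leaves (y1 \<or>\<^sub>t y2) = leaves y1 + leaves y2"

definition Y :: "nat \<Rightarrow> tree set"
  where "Y n = {y. leaves y = n + 1}"

definition tree21 :: tree
  where "tree21 = Leaf \<or>\<^sub>t (Leaf \<or>\<^sub>t Leaf)"

definition tree12 :: tree
  where "tree12 = (Leaf \<or>\<^sub>t Leaf) \<or>\<^sub>t Leaf"

text \<open>Deletion of the \<open>i\<close>th leaf; the vertex carrying it disappears, so that its sibling
  subtree takes the place of that vertex. The value on \<open>Leaf\<close> is irrelevant.\<close>

fun del :: "nat \<Rightarrow> tree \<Rightarrow> tree" where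
  "del i Leaf = Leaf"
| "del i (y1 \<or>\<^sub>t y2) =
     (if i < leaves y1
      then (if y1 = Leaf then y2 else del i y1 \<or>\<^sub>t y2)
      else (if y2 = Leaf then y1 else y1 \<or>\<^sub>t del (i - leaves y1) y2))"

text \<open>Whether the \<open>i\<close>th leaf is the left branch at the vertex it is attached to.\<close>

fun is_left_leaf :: "nat \<Rightarrow> tree \<Rightarrow> bool" where
  "is_left_leaf i Leaf = False"
| "is_left_leaf i (y1 \<or>\<^sub>t y2) =
     (if i < leaves y1
      then (if y1 = Leaf then True else is_left_leaf i y1)
      else (if y2 = Leaf then False else is_left_leaf (i - leaves y1) y2))"

text \<open>The symbol attached to leaf \<open>i\<close> of a tree in \<open>Y (n + 1)\<close>; the last leaf has number \<open>n + 1\<close>.\<close>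

definition circ :: "nat \<Rightarrow> tree \<Rightarrow> nat \<Rightarrow> side"
  where "circ n y i =
    (if i = 0 then (if \<exists>y1. y = Leaf \<or>\<^sub>t y1 then Lft else Rgt)
     else if i = n + 1 then (if \<exists>y1. y = y1 \<or>\<^sub>t Leaf then Rgt else Lft)
     else (if is_left_leaf i y then Lft else Rgt))"


section \<open>Dialgebra cochains\<close>

text \<open>A linear map on \<open>K[Y_n] \<otimes> D^n\<close> is given by a multilinear map on \<open>n\<close>-tuples (lists of length
  \<open>n\<close>) for every \<open>n\<close>-tree. Cochains are normalised to be zero on arguments of the wrong size, so that
  equality and addition of cochains are those of functions.\<close>

type_synonym ('d, 'm) cochain = "tree \<Rightarrow> 'd list \<Rightarrow> 'm"

definition CY :: "('k::field, 'd::ab_group_add) dialg \<Rightarrow> ('k, 'd, 'm::ab_group_add) rep \<Rightarrow>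
    nat \<Rightarrow> ('d, 'm) cochain set"
  where "CY D M n = {f.
    (\<forall>y xs. y \<notin> Y n \<or> length xs \<noteq> n \<longrightarrow> f y xs = 0) \<and>
    (\<forall>y\<in>Y n. \<forall>xs i. length xs = n \<longrightarrow> i < n \<longrightarrow>
       Vector_Spaces.linear (smul D) (msmul M) (\<lambda>a. f y (xs[i := a])))}"

text \<open>The map \<open>\<delta>^i\<close> on \<open>n\<close>-cochains. Here \<open>a\<^sub>j\<close> is \<open>xs ! (j - 1)\<close>.\<close>

definition coface :: "('k, 'd) dialg \<Rightarrow> ('k, 'd, 'm) rep \<Rightarrow> nat \<Rightarrow> nat \<Rightarrow>
    ('d, 'm) cochain \<Rightarrow> ('d, 'm) cochain"
  where "coface D M n i f y xs =
    (if i = 0 then lact M (circ n y 0) (hd xs) (f (del 0 y) (tl xs))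
     else if i = n + 1 then ract M (circ n y (n + 1)) (f (del (n + 1) y) (butlast xs)) (last xs)
     else f (del i y)
       (take (i - 1) xs @ [dprod D (circ n y i) (xs ! (i - 1)) (xs ! i)] @ drop (i + 1) xs))"

definition delta :: "('k::field, 'd) dialg \<Rightarrow> ('k, 'd, 'm::ab_group_add) rep \<Rightarrow> nat \<Rightarrow>
    ('d, 'm) cochain \<Rightarrow> ('d, 'm) cochain"
  where "delta D M n f y xs =
    (if y \<in> Y (n + 1) \<and> length xs = n + 1
     then \<Sum>i\<le>n + 1. msmul M ((- 1) ^ i) (coface D M n i f y xs)
     else 0)"


section \<open>The deformation complex of a morphism\<close>

type_synonym ('d, 'e) mcochain = "('d, 'd) cochain \<times> ('e, 'e) cochain \<times> ('d, 'e) cochain"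

text \<open>The complex starts in degree 1; it is extended by the zero group in degree 0.\<close>

definition CYm :: "('k::field, 'd::ab_group_add) dialg \<Rightarrow> ('k, 'e::ab_group_add) dialg \<Rightarrow>
    ('d \<Rightarrow> 'e) \<Rightarrow> nat \<Rightarrow> ('d, 'e) mcochain set"
  where "CYm D E \<psi> n =
    (if n = 0 then {0}
     else CY D (self_rep D) n \<times> CY E (self_rep E) n \<times> CY D (rep_via \<psi> E) (n - 1))"

definition deltam :: "('k::field, 'd::ab_group_add) dialg \<Rightarrow> ('k, 'e::ab_group_add) dialg \<Rightarrow>
    ('d \<Rightarrow> 'e) \<Rightarrow> nat \<Rightarrow> ('d, 'e) mcochain \<Rightarrow> ('d, 'e) mcochain"
  where "deltam D E \<psi> n = (\<lambda>(\<xi>, \<pi>, \<phi>).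
    (delta D (self_rep D) n \<xi>,
     delta E (self_rep E) n \<pi>,
     (\<lambda>y xs. \<psi> (\<xi> y xs) - \<pi> y (map \<psi> xs) - delta D (rep_via \<psi> E) (n - 1) \<phi> y xs)))"

definition ZYm :: "('k::field, 'd::ab_group_add) dialg \<Rightarrow> ('k, 'e::ab_group_add) dialg \<Rightarrow>
    ('d \<Rightarrow> 'e) \<Rightarrow> nat \<Rightarrow> ('d, 'e) mcochain set"
  where "ZYm D E \<psi> n = {c \<in> CYm D E \<psi> n. deltam D E \<psi> n c = 0}"

definition BYm :: "('k::field, 'd::ab_group_add) dialg \<Rightarrow> ('k, 'e::ab_group_add) dialg \<Rightarrow>
    ('d \<Rightarrow> 'e) \<Rightarrow> nat \<Rightarrow> ('d, 'e) mcochain set"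
  where "BYm D E \<psi> n = deltam D E \<psi> (n - 1) ` CYm D E \<psi> (n - 1)"

definition HY :: "('k::field, 'd::ab_group_add) dialg \<Rightarrow> ('k, 'e::ab_group_add) dialg \<Rightarrow>
    ('d \<Rightarrow> 'e) \<Rightarrow> nat \<Rightarrow> ('d, 'e) mcochain set monoid"
  where "HY D E \<psi> n =
    \<lparr>carrier = ZYm D E \<psi> n, monoid.mult = (+), one = 0\<rparr> Mod BYm D E \<psi> n"


section \<open>Deformations\<close>

type_synonym 'd bilin_seq = "nat \<Rightarrow> 'd \<Rightarrow> 'd \<Rightarrow> 'd"

definition fps_smul :: "('k \<Rightarrow> 'd \<Rightarrow> 'd) \<Rightarrow> 'k \<Rightarrow> 'd fps \<Rightarrow> 'd fps"
  where "fps_smul s c a = Abs_fps (\<lambda>i. s c (fps_nth a i))"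

definition fps_bilin :: "('d::ab_group_add) bilin_seq \<Rightarrow> 'd fps \<Rightarrow> 'd fps \<Rightarrow> 'd fps"
  where "fps_bilin F a b =
    Abs_fps (\<lambda>m. \<Sum>n\<le>m. \<Sum>i\<le>m - n. F n (fps_nth a i) (fps_nth b (m - n - i)))"

definition fps_lin :: "(nat \<Rightarrow> 'd \<Rightarrow> 'e::ab_group_add) \<Rightarrow> 'd fps \<Rightarrow> 'e fps"
  where "fps_lin \<psi> a = Abs_fps (\<lambda>m. \<Sum>n\<le>m. \<psi> n (fps_nth a (m - n)))"

definition deformed :: "('k, 'd::ab_group_add) dialg \<Rightarrow> 'd bilin_seq \<times> 'd bilin_seq \<Rightarrow>
    ('k, 'd fps) dialg"
  where "deformed D f =
    \<lparr>smul = fps_smul (smul D), lprod = fps_bilin (fst f), rprod = fps_bilin (snd f)\<rparr>"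

definition dialgebra_deformation ::
  "('k::field, 'd::ab_group_add) dialg \<Rightarrow> 'd bilin_seq \<times> 'd bilin_seq \<Rightarrow> bool"
  where "dialgebra_deformation D f \<longleftrightarrow>
    (\<forall>n. bilin (smul D) (smul D) (smul D) (fst f n)) \<and>
    (\<forall>n. bilin (smul D) (smul D) (smul D) (snd f n)) \<and>
    fst f 0 = lprod D \<and> snd f 0 = rprod D \<and>
    dialgebra (deformed D f)"

type_synonym ('d, 'e) mdeformation =
  "('d bilin_seq \<times> 'd bilin_seq) \<times> ('e bilin_seq \<times> 'e bilin_seq) \<times> (nat \<Rightarrow> 'd \<Rightarrow> 'e)"

definition morphism_deformation :: "('k::field, 'd::ab_group_add) dialg \<Rightarrow>
    ('k, 'e::ab_group_add) dialg \<Rightarrow> ('d \<Rightarrow> 'e) \<Rightarrow> ('d, 'e) mdeformation \<Rightarrow> bool"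
  where "morphism_deformation D E \<psi> = (\<lambda>(fD, fE, \<Psi>).
    dialgebra_deformation D fD \<and> dialgebra_deformation E fE \<and>
    (\<forall>n. Vector_Spaces.linear (smul D) (smul E) (\<Psi> n)) \<and> \<Psi> 0 = \<psi> \<and>
    dialgebra_morphism (deformed D fD) (deformed E fE) (fps_lin \<Psi>))"

definition cochain2 :: "('d \<Rightarrow> 'd \<Rightarrow> 'd) \<Rightarrow> ('d \<Rightarrow> 'd \<Rightarrow> 'd) \<Rightarrow> ('d, 'd::zero) cochain"
  where "cochain2 Fl Fr y xs =
    (if length xs = 2 \<and> y = tree21 then Fl (xs ! 0) (xs ! 1)
     else if length xs = 2 \<and> y = tree12 then Fr (xs ! 0) (xs ! 1)
     else 0)"

definition cochain1 :: "('d \<Rightarrow> 'e) \<Rightarrow> ('d, 'e::zero) cochain"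
  where "cochain1 g y xs = (if length xs = 1 \<and> y = Leaf \<or>\<^sub>t Leaf then g (xs ! 0) else 0)"

definition theta :: "('d::zero, 'e::zero) mdeformation \<Rightarrow> nat \<Rightarrow> ('d, 'e) mcochain"
  where "theta = (\<lambda>(fD, fE, \<Psi>) n.
    (cochain2 (fst fD n) (snd fD n), cochain2 (fst fE n) (snd fE n), cochain1 (\<Psi> n)))"

definition infinitesimal :: "('d::zero, 'e::zero) mdeformation \<Rightarrow> ('d, 'e) mcochain"
  where "infinitesimal \<Theta> = theta \<Theta> 1"

end

theory Submission
  imports Defs
begin

text \<open>
  A deformation is built one coefficient at a time, starting from \<open>\<psi>\<close> and the given cocycle. If the
  coefficients below \<open>t^N\<close> are compatible, the \<open>t^N\<close>-coefficients of the five associators of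
  \<open>D[[t]]\<close>, of those of \<open>E[[t]]\<close> and of \<open>\<psi>\<^sub>t (a * b) - \<psi>\<^sub>t a * \<psi>\<^sub>t b\<close> form an obstruction
  in degree 3, and adding a term \<open>\<theta>\<^sub>N t^N\<close> changes it by \<open>\<delta> \<theta>\<^sub>N\<close>. The obstruction is a
  cocycle because the associators of \<^emph>\<open>arbitrary\<close> biadditive products satisfy a five-term
  (pentagon) identity for each 4-tree, as does the multiplicativity defect of an additive map for
  each 3-tree; comparing the \<open>t^N\<close>-coefficients of these identities over power series gives the
  cocycle condition, all terms of lower order being zero. As \<open>HY^3\<close> vanishes, \<open>\<theta>\<^sub>N\<close> exists.
\<close>

section \<open>Trees with at most five leaves\<close>

lemma leaves_pos: "0 < leaves y"
  by (induction y) auto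

lemma Y_0: "Y 0 = {Leaf}"
proof -
  have "leaves y = 1 \<longleftrightarrow> y = Leaf" for y
  proof (cases y)
    case (Graft u v)
    with leaves_pos[of u] leaves_pos[of v] show ?thesis by simp
  qed simp
  then show ?thesis by (auto simp: Y_def)
qed

lemma Y_Suc: "Y (Suc n) = (\<Union>i\<le>n. (\<lambda>(u, v). u \<or>\<^sub>t v) ` (Y i \<times> Y (n - i)))"
proof (intro equalityI subsetI)
  fix y assume y: "y \<in> Y (Suc n)"
  then obtain u v where uv: "y = u \<or>\<^sub>t v" "leaves u + leaves v = n + 2"
    by (cases y) (auto simp: Y_def)
  with leaves_pos[of u] leaves_pos[of v]
  have "u \<in> Y (leaves u - 1)" "v \<in> Y (n - (leaves u - 1))" "leaves u - 1 \<le> n"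
    by (auto simp: Y_def)
  with uv show "y \<in> (\<Union>i\<le>n. (\<lambda>(u, v). u \<or>\<^sub>t v) ` (Y i \<times> Y (n - i)))" by blast
qed (auto simp: Y_def)

lemma Y_1: "Y 1 = {Leaf \<or>\<^sub>t Leaf}"
  unfolding One_nat_def Y_Suc by (simp add: Y_0)

lemma Y_2: "Y 2 = {tree21, tree12}"
  unfolding numeral_2_eq_2 Y_Suc[of "Suc 0"]
  using Y_1 by (auto simp: atMost_Suc Y_0 tree21_def tree12_def)

lemma Y_3: "Y 3 = {Leaf \<or>\<^sub>t tree21, Leaf \<or>\<^sub>t tree12, (Leaf \<or>\<^sub>t Leaf) \<or>\<^sub>t (Leaf \<or>\<^sub>t Leaf),
    tree21 \<or>\<^sub>t Leaf, tree12 \<or>\<^sub>t Leaf}"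
  unfolding numeral_3_eq_3 Y_Suc[of "Suc (Suc 0)"]
  using Y_1 Y_2 by (auto simp: atMost_Suc Y_0 numeral_2_eq_2)

lemma Y_4: "Y 4 = (\<lambda>v. Leaf \<or>\<^sub>t v) ` Y 3 \<union> (\<lambda>u. u \<or>\<^sub>t Leaf) ` Y 3 \<union>
   (\<lambda>v. (Leaf \<or>\<^sub>t Leaf) \<or>\<^sub>t v) ` Y 2 \<union> (\<lambda>u. u \<or>\<^sub>t (Leaf \<or>\<^sub>t Leaf)) ` Y 2"
proof -
  have "Y 4 = Y (Suc 3)" by simp
  also have "\<dots> = (\<Union>i\<in>{0,1,2,3}. (\<lambda>(u, v). u \<or>\<^sub>t v) ` (Y i \<times> Y (3 - i)))"
    unfolding Y_Suc by (rule SUP_cong) (auto simp: atMost_Suc numeral_3_eq_3)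
  finally show ?thesis using Y_1 by (auto simp: Y_0)
qed


section \<open>Associators and pentagon identities\<close>

text \<open>The index \<open>s\<close> lets one locale cover the products for both symbols. Scalars
  are left out, so that products of coefficients and products of power series are treated
  alike.\<close>

locale biadditive =
  fixes p :: "side \<Rightarrow> 'a::ab_group_add \<Rightarrow> 'b::ab_group_add \<Rightarrow> 'c::ab_group_add"
  assumes addl: "p s (a + b) c = p s a c + p s b c"
    and addr: "p s x (y + z) = p s x y + p s x z"
begin

lemma zerol [simp]: "p s 0 c = 0" using addl[of s 0 0 c] by simp
lemma zeror [simp]: "p s x 0 = 0" using addr[of s x 0 0] by simp
lemma diffl: "p s (a - b) c = p s a c - p s b c" using addl[of s "a - b" b c] by simp
lemma diffr: "p s x (y - z) = p s x y - p s x z" using addr[of s x "y - z" z] by simp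
lemma minusl: "p s (- b) c = - p s b c" using diffl[of s 0 b c] by simp
lemma minusr: "p s x (- z) = - p s x z" using diffr[of s x 0 z] by simp

end

text \<open>For the products of a dialgebra, the five 3-trees give the axioms (1)--(5). By the lemma
  \<open>side_of_del\<close> the labels agree with those of the coboundary of a 2-cochain.\<close>

definition associator :: "(side \<Rightarrow> 'a::ab_group_add \<Rightarrow> 'a \<Rightarrow> 'a) \<Rightarrow> tree \<Rightarrow> 'a \<Rightarrow> 'a \<Rightarrow> 'a \<Rightarrow> 'a"
  where "associator p y a b c =
    p (circ 2 y 0) a (p (circ 2 y 2) b c) - p (circ 2 y 3) (p (circ 2 y 1) a b) c"

text \<open>The dictionary by which a 2-cochain becomes a pair of products. Its meaning is confined
  to 2-trees; on other trees \<open>Rgt\<close> is only a default value.\<close>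

definition side_of :: "tree \<Rightarrow> side"
  where "side_of y = (if y = tree21 then Lft else Rgt)"

lemma side_of_del:
  assumes "y \<in> Y 3"
  shows "side_of (del 0 y) = circ 2 y 2" "side_of (del 1 y) = circ 2 y 3"
    "side_of (del 2 y) = circ 2 y 0" "side_of (del 3 y) = circ 2 y 1"
  using assms unfolding Y_3 by (auto simp: side_of_def circ_def tree21_def tree12_def)

text \<open>No dialgebra axiom is involved: each of the five bracketings of \<open>a, b, c, d\<close> occurs twice, with
  the same product symbols and opposite signs.\<close>

lemma pentagon:
  fixes p :: "side \<Rightarrow> 'a::ab_group_add \<Rightarrow> 'a \<Rightarrow> 'a"
  assumes "biadditive p" and "y \<in> Y 4"
  shows "p (circ 3 y 0) a (associator p (del 0 y) b c d)
    - associator p (del 1 y) (p (circ 3 y 1) a b) c d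
    + associator p (del 2 y) a (p (circ 3 y 2) b c) d
    - associator p (del 3 y) a b (p (circ 3 y 3) c d)
    + p (circ 3 y 4) (associator p (del 4 y) a b c) d = 0"
proof -
  interpret biadditive p by fact
  show ?thesis
    using \<open>y \<in> Y 4\<close> unfolding Y_4 Y_3 Y_2 image_insert image_empty Un_insert_left Un_empty_left
    by (elim insertE emptyE)
      (simp_all add: associator_def circ_def tree21_def tree12_def, simp_all add: diffl diffr)
qed

section \<open>The multiplicativity defect of an additive map\<close>

definition morphism_defect where
  "morphism_defect p q T s a b = T (p s a b) - q s (T a) (T b)"

text \<open>On the right the mixed terms, in which \<open>T\<close> is applied to the product of two
  neighbouring arguments and the third is mapped separately, occur twice with opposite signs. What
  remains is \<open>T\<close> of the two bracketings and the two bracketings of the images. The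
  symbols match by \<open>side_of_del\<close>.\<close>

lemma morphism_pentagon:
  fixes p :: "side \<Rightarrow> 'a::ab_group_add \<Rightarrow> 'a \<Rightarrow> 'a"
    and q :: "side \<Rightarrow> 'b::ab_group_add \<Rightarrow> 'b \<Rightarrow> 'b"
  assumes "biadditive q" and T: "\<And>a b. T (a + b) = T a + T b" and "y \<in> Y 3"
  shows "T (associator p y a b c) - associator q y (T a) (T b) (T c)
    = q (circ 2 y 0) (T a) (morphism_defect p q T (side_of (del 0 y)) b c)
    - morphism_defect p q T (side_of (del 1 y)) (p (circ 2 y 1) a b) c
    + morphism_defect p q T (side_of (del 2 y)) a (p (circ 2 y 2) b c)
    - q (circ 2 y 3) (morphism_defect p q T (side_of (del 3 y)) a b) (T c)"
proof -
  interpret biadditive q by fact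
  have "T (a - b) = T a - T b" for a b
    using T[of "a - b" b] by simp
  then show ?thesis
    using \<open>y \<in> Y 3\<close> by (simp add: associator_def morphism_defect_def
        side_of_del(1,3,4) side_of_del(2)[unfolded One_nat_def] diffl diffr)
qed


section \<open>Power series with coefficients in an abelian group\<close>

text \<open>Multiplication by the variable t, given by coefficients because these form only a
  group.\<close>

definition fps_push :: "'a::zero fps \<Rightarrow> 'a fps"
  where "fps_push a = Abs_fps (\<lambda>n. if n = 0 then 0 else fps_nth a (n - 1))"

lemma fps_push_nth [simp]: "fps_nth (fps_push a) n = (if n = 0 then 0 else fps_nth a (n - 1))"
  by (simp add: fps_push_def)

lemma fps_push_diff: "fps_push (a - b) = fps_push a - fps_push (b :: 'a::ab_group_add fps)"
  by (simp add: fps_eq_iff)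

lemma fps_const_plus_push: "a = fps_const (fps_nth a 0) + fps_push (fps_shift 1 a)"
  for a :: "'a::ab_group_add fps"
  by (simp add: fps_eq_iff)

text \<open>The substitute for \<open>K[[t]]\<close>-linearity when the coefficients carry only an additive structure.\<close>

definition t_linear :: "('a::ab_group_add fps \<Rightarrow> 'b::ab_group_add fps) \<Rightarrow> bool"
  where "t_linear T \<longleftrightarrow> (\<forall>a b. T (a + b) = T a + T b) \<and> (\<forall>a. T (fps_push a) = fps_push (T a))"

lemma t_linear_compose: "t_linear S \<Longrightarrow> t_linear T \<Longrightarrow> t_linear (\<lambda>a. S (T a))"
  by (simp add: t_linear_def)

lemma t_linear_diff: "t_linear S \<Longrightarrow> t_linear T \<Longrightarrow> t_linear (\<lambda>a. S a - T a)"
  by (simp add: t_linear_def fps_push_diff)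

text \<open>Write a = a_0 + t a'. Then T a = T a_0 + t T a', so each coefficient reduces to a
  constant argument and to a coefficient of lower index. Iterating this replaces any appeal to
  infinite sums or continuity.\<close>

lemma t_linear_nth:
  assumes "t_linear T"
  shows "fps_nth (T a) n = fps_nth (T (fps_const (fps_nth a 0))) n
    + (if n = 0 then 0 else fps_nth (T (fps_shift 1 a)) (n - 1))"
proof -
  have "T a = T (fps_const (fps_nth a 0)) + fps_push (T (fps_shift 1 a))"
    using assms fps_const_plus_push[of a] unfolding t_linear_def by metis
  then show ?thesis by simp
qed

text \<open>Induction along \<open>t_linear_nth\<close>: low coefficients need to be tested on
  constant series only.\<close>

lemma t_linear_vanish:
  assumes "t_linear T" and "\<And>m x. m < N \<Longrightarrow> fps_nth (T (fps_const x)) m = 0" and "m < N"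
  shows "fps_nth (T a) m = 0"
  using \<open>m < N\<close>
proof (induction m arbitrary: a)
  case (Suc m)
  then show ?case using assms(2) t_linear_nth[OF assms(1), of a "Suc m"] by simp
next
  case 0
  then show ?case using assms(2) t_linear_nth[OF assms(1), of a 0] by simp
qed

text \<open>The part of the argument divisible by t contributes a coefficient of index N - 1, which
  is zero.\<close>

lemma t_linear_leading:
  assumes "t_linear T" and "\<And>m a. m < N \<Longrightarrow> fps_nth (T a) m = 0"
  shows "fps_nth (T a) N = fps_nth (T (fps_const (fps_nth a 0))) N"
  using t_linear_nth[OF assms(1), of a N] assms(2) by simp

lemma fps_lin_const: "(\<And>n. P n 0 = 0) \<Longrightarrow> fps_nth (fps_lin P (fps_const a)) n = P n a"
  by (simp add: fps_lin_def if_distrib[of "P _"] sum.delta' cong: if_cong)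

lemma fps_lin_t_linear:
  assumes "\<And>n a b. P n (a + b) = P n a + P n b"
  shows "t_linear (fps_lin P)"
proof -
  have [simp]: "P n 0 = 0" for n using assms[of n 0 0] by simp
  have "fps_nth (fps_lin P (fps_push a)) n = fps_nth (fps_push (fps_lin P a)) n" for a n
    by (cases n) (auto simp: fps_lin_def atMost_Suc Suc_diff_le intro!: sum.cong)
  then show ?thesis
    by (simp add: t_linear_def fps_eq_iff) (simp add: fps_lin_def assms sum.distrib)
qed

lemma fps_lin_leading:
  assumes "\<And>n. P n 0 = 0" and "\<And>m. m < N \<Longrightarrow> fps_nth a m = 0"
  shows "fps_nth (fps_lin P a) N = P 0 (fps_nth a N)"
proof -
  have "fps_nth (fps_lin P a) N = (\<Sum>n\<in>{0}. P n (fps_nth a (N - n)))"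
    unfolding fps_lin_def fps_nth_Abs_fps by (rule sum.mono_neutral_right) (auto simp: assms)
  then show ?thesis by simp
qed


section \<open>Products of power series\<close>

definition series_prod :: "(nat \<Rightarrow> side \<Rightarrow> 'a::ab_group_add \<Rightarrow> 'a \<Rightarrow> 'a) \<Rightarrow> side \<Rightarrow> 'a fps \<Rightarrow> 'a fps \<Rightarrow> 'a fps"
  where "series_prod F s = fps_bilin (\<lambda>n. F n s)"

locale product_family =
  fixes F :: "nat \<Rightarrow> side \<Rightarrow> 'a::ab_group_add \<Rightarrow> 'a \<Rightarrow> 'a"
  assumes biadditive_family: "biadditive (F n)"
begin

sublocale coeff: biadditive "F n" for n
  by (rule biadditive_family)

lemma series_prod_nth:
  "fps_nth (series_prod F s a b) m
    = (\<Sum>n\<le>m. \<Sum>i\<le>m - n. F n s (fps_nth a i) (fps_nth b (m - n - i)))"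
  by (simp add: series_prod_def fps_bilin_def)

text \<open>This makes the pentagon identities available for the products of power series, whether
  or not they satisfy the dialgebra axioms.\<close>

sublocale series: biadditive "series_prod F"
  by unfold_locales
    (simp_all add: fps_eq_iff series_prod_nth coeff.addl coeff.addr sum.distrib)

lemma series_prod_const_left:
  "fps_nth (series_prod F s (fps_const a) b) m = (\<Sum>n\<le>m. F n s a (fps_nth b (m - n)))"
proof -
  have "(\<Sum>i\<le>m - n. F n s (if i = 0 then a else 0) (fps_nth b (m - n - i)))
    = F n s a (fps_nth b (m - n))" for n
    by (subst sum.remove[of _ 0]) (auto intro!: sum.neutral)
  then show ?thesis by (simp only: series_prod_nth fps_nth_fps_const)
qed

lemma series_prod_const_right:
  "fps_nth (series_prod F s a (fps_const b)) m = (\<Sum>n\<le>m. F n s (fps_nth a (m - n)) b)"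
proof -
  have "(\<Sum>i\<le>m - n. F n s (fps_nth a i) (if m - n - i = 0 then b else 0))
    = F n s (fps_nth a (m - n)) b" for n
    by (subst sum.remove[of _ "m - n"]) (auto intro!: sum.neutral split: if_splits)
  then show ?thesis by (simp only: series_prod_nth fps_nth_fps_const)
qed

lemma series_prod_const: "series_prod F s (fps_const a) (fps_const b) = Abs_fps (\<lambda>m. F m s a b)"
proof (rule fps_ext)
  fix m
  show "fps_nth (series_prod F s (fps_const a) (fps_const b)) m = fps_nth (Abs_fps (\<lambda>m. F m s a b)) m"
    unfolding series_prod_const_left by (subst sum.remove[of _ m]) (auto intro!: sum.neutral)
qed

text \<open>The summands are indexed by n + i + j = N, where j is the index in \<open>b\<close>.
  Those with j < N vanish, which leaves n = i = 0.\<close>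

lemma series_prod_leading_right:
  assumes "\<And>m. m < N \<Longrightarrow> fps_nth b m = 0"
  shows "fps_nth (series_prod F s a b) N = F 0 s (fps_nth a 0) (fps_nth b N)"
proof -
  have "fps_nth (series_prod F s a b) N
      = (\<Sum>n\<in>{0}. \<Sum>i\<le>N - n. F n s (fps_nth a i) (fps_nth b (N - n - i)))"
    unfolding series_prod_nth
    by (rule sum.mono_neutral_right) (auto simp: assms intro!: sum.neutral)
  also have "\<dots> = (\<Sum>i\<le>N. F 0 s (fps_nth a i) (fps_nth b (N - i)))" by simp
  also have "\<dots> = (\<Sum>i\<in>{0}. F 0 s (fps_nth a i) (fps_nth b (N - i)))"
    by (rule sum.mono_neutral_right) (auto simp: assms)
  finally show ?thesis by simp
qed

lemma series_prod_leading_left: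
  assumes "\<And>m. m < N \<Longrightarrow> fps_nth a m = 0"
  shows "fps_nth (series_prod F s a b) N = F 0 s (fps_nth a N) (fps_nth b 0)"
proof -
  have "fps_nth (series_prod F s a b) N
      = (\<Sum>n\<in>{0}. \<Sum>i\<le>N - n. F n s (fps_nth a i) (fps_nth b (N - n - i)))"
    unfolding series_prod_nth
    by (rule sum.mono_neutral_right) (auto simp: assms intro!: sum.neutral)
  also have "\<dots> = (\<Sum>i\<le>N. F 0 s (fps_nth a i) (fps_nth b (N - i)))" by simp
  also have "\<dots> = (\<Sum>i\<in>{N}. F 0 s (fps_nth a i) (fps_nth b (N - i)))"
    by (rule sum.mono_neutral_right) (auto simp: assms)
  finally show ?thesis by simp
qed

lemma series_prod_push_left: "series_prod F s (fps_push a) b = fps_push (series_prod F s a b)"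
proof (rule fps_ext)
  fix m
  show "fps_nth (series_prod F s (fps_push a) b) m = fps_nth (fps_push (series_prod F s a b)) m"
  proof (cases m)
    case (Suc k)
    \<comment> \<open>The summand i = 0 drops out because the shifted series has constant term 0;
      the others are renumbered.\<close>
    have "(\<Sum>i\<le>Suc k - n. F n s (fps_nth (fps_push a) i) (fps_nth b (Suc k - n - i)))
        = (\<Sum>i\<le>k - n. F n s (fps_nth a i) (fps_nth b (k - n - i)))" if "n \<le> k" for n
      unfolding Suc_diff_le[OF that] sum.atMost_Suc_shift by simp
    then show ?thesis by (simp add: Suc series_prod_nth)
  qed (simp add: series_prod_nth)
qed

lemma series_prod_push_right: "series_prod F s a (fps_push b) = fps_push (series_prod F s a b)"
proof (rule fps_ext)
  fix m
  show "fps_nth (series_prod F s a (fps_push b)) m = fps_nth (fps_push (series_prod F s a b)) m"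
    by (cases m) (auto simp: series_prod_nth Suc_diff_le intro!: sum.cong)
qed

lemma series_prod_t_linear:
  "t_linear (\<lambda>a. series_prod F s a b)" "t_linear (\<lambda>b. series_prod F s a b)"
  by (simp_all add: t_linear_def series.addl series.addr series_prod_push_left series_prod_push_right)

end


section \<open>The obstruction cochains are cocycles\<close>

lemma leaves_del: "y \<noteq> Leaf \<Longrightarrow> leaves (del i y) = leaves y - 1"
proof (induction y arbitrary: i)
  case (Graft u v)
  then show ?case
    using leaves_pos[of u] leaves_pos[of v] by (auto simp: Suc_le_eq)
qed simp

lemma del_in_Y: "y \<in> Y (Suc n) \<Longrightarrow> del i y \<in> Y n"
  using leaves_del[of y i] by (cases "y = Leaf") (auto simp: Y_def)

text \<open>The t^n-coefficient of the associator of the deformed products on constant series. Its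
  vanishing for all 3-trees is the deformation equation of order n.\<close>

definition assoc_coeff ::
  "(nat \<Rightarrow> side \<Rightarrow> 'a::ab_group_add \<Rightarrow> 'a \<Rightarrow> 'a) \<Rightarrow> nat \<Rightarrow> tree \<Rightarrow> 'a \<Rightarrow> 'a \<Rightarrow> 'a \<Rightarrow> 'a"
  where "assoc_coeff F n y a b c =
    (\<Sum>i\<le>n. F i (circ 2 y 0) a (F (n - i) (circ 2 y 2) b c))
    - (\<Sum>i\<le>n. F i (circ 2 y 3) (F (n - i) (circ 2 y 1) a b) c)"

context product_family
begin

lemma associator_const:
  "fps_nth (associator (series_prod F) y (fps_const a) (fps_const b) (fps_const c)) n
    = assoc_coeff F n y a b c"
  by (simp add: associator_def assoc_coeff_def series_prod_const_left series_prod_const_right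
      series_prod_const)

lemma associator_t_linear:
  "t_linear (\<lambda>a. associator (series_prod F) y a b c)"
  "t_linear (\<lambda>b. associator (series_prod F) y a b c)"
  "t_linear (\<lambda>c. associator (series_prod F) y a b c)"
  unfolding associator_def
  by (intro t_linear_diff series_prod_t_linear
      t_linear_compose[OF series_prod_t_linear(1) series_prod_t_linear(1)]
      t_linear_compose[OF series_prod_t_linear(1) series_prod_t_linear(2)]
      t_linear_compose[OF series_prod_t_linear(2) series_prod_t_linear(1)]
      t_linear_compose[OF series_prod_t_linear(2) series_prod_t_linear(2)])+

text \<open>The associator is t-linear in each argument separately, so the three arguments are
  released from being constant one after the other.\<close>

lemma associator_vanish:
  assumes "\<And>m a b c. m < N \<Longrightarrow> assoc_coeff F m y a b c = 0" and "m < N"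
  shows "fps_nth (associator (series_prod F) y a b c) m = 0"
proof -
  have "fps_nth (associator (series_prod F) y (fps_const a) (fps_const b) c) m = 0"
    if "m < N" for m a b c
    using associator_t_linear(3) _ that
    by (rule t_linear_vanish) (simp add: associator_const assms)
  then have "fps_nth (associator (series_prod F) y (fps_const a) b c) m = 0" if "m < N" for m a b c
    using that by (rule t_linear_vanish[OF associator_t_linear(2)])
  then show ?thesis
    using \<open>m < N\<close> by (rule t_linear_vanish[OF associator_t_linear(1)])
qed

lemma associator_leading:
  assumes "\<And>m a b c. m < N \<Longrightarrow> assoc_coeff F m y a b c = 0"
  shows "fps_nth (associator (series_prod F) y a b c) N
    = assoc_coeff F N y (fps_nth a 0) (fps_nth b 0) (fps_nth c 0)"
  using t_linear_leading[OF associator_t_linear(1), of N y b c a]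
    t_linear_leading[OF associator_t_linear(2), of N y _ c b]
    t_linear_leading[OF associator_t_linear(3), of N y _ _ c]
    associator_vanish[OF assms] by (simp add: associator_const)

text \<open>This is the t^N-coefficient of the pentagon identity over power series, at constant
  arguments. All associators start in degree N, so an outer product contributes only
  \<open>F 0\<close>, and of a product inside an associator only the constant term, again given by
  \<open>F 0\<close>, is seen.\<close>

lemma assoc_coeff_cocycle:
  assumes "\<And>m y a b c. m < N \<Longrightarrow> y \<in> Y 3 \<Longrightarrow> assoc_coeff F m y a b c = 0" and "y \<in> Y 4"
  shows "F 0 (circ 3 y 0) a (assoc_coeff F N (del 0 y) b c d)
    - assoc_coeff F N (del 1 y) (F 0 (circ 3 y 1) a b) c d
    + assoc_coeff F N (del 2 y) a (F 0 (circ 3 y 2) b c) d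
    - assoc_coeff F N (del 3 y) a b (F 0 (circ 3 y 3) c d)
    + F 0 (circ 3 y 4) (assoc_coeff F N (del 4 y) a b c) d = 0"
proof -
  have "del i y \<in> Y 3" for i
    using del_in_Y[of y 3] \<open>y \<in> Y 4\<close> by simp
  then have 0: "assoc_coeff F m (del i y) a b c = 0" if "m < N" for i m a b c
    using assms(1) that by blast
  have vanish: "fps_nth (associator (series_prod F) (del i y) u v w) m = 0" if "m < N" for i m u v w
    by (rule associator_vanish[OF 0 that])
  from arg_cong[OF pentagon[where a = "fps_const a" and b = "fps_const b" and c = "fps_const c"
        and d = "fps_const d", OF series.biadditive_axioms \<open>y \<in> Y 4\<close>],
      of "\<lambda>x. fps_nth x N"]
  show ?thesis
    by (simp add: associator_leading[where N = N, OF 0] series_prod_leading_left series_prod_leading_right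
        vanish series_prod_const)
qed

end

section \<open>Coefficients of the multiplicativity defect of a power series of maps\<close>

definition morphism_coeff :: "(nat \<Rightarrow> side \<Rightarrow> 'a \<Rightarrow> 'a \<Rightarrow> 'a) \<Rightarrow>
    (nat \<Rightarrow> side \<Rightarrow> 'b \<Rightarrow> 'b \<Rightarrow> 'b) \<Rightarrow> (nat \<Rightarrow> 'a \<Rightarrow> 'b::ab_group_add) \<Rightarrow> nat \<Rightarrow> side \<Rightarrow> 'a \<Rightarrow> 'a \<Rightarrow> 'b"
  where "morphism_coeff F G P n s a b =
    (\<Sum>i\<le>n. P i (F (n - i) s a b)) - (\<Sum>i\<le>n. \<Sum>j\<le>n - i. G i s (P j a) (P (n - i - j) b))"

locale morphism_family = F: product_family F + G: product_family G
  for F :: "nat \<Rightarrow> side \<Rightarrow> 'a::ab_group_add \<Rightarrow> 'a \<Rightarrow> 'a"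
    and G :: "nat \<Rightarrow> side \<Rightarrow> 'b::ab_group_add \<Rightarrow> 'b \<Rightarrow> 'b" +
  fixes P :: "nat \<Rightarrow> 'a \<Rightarrow> 'b"
  assumes P_add: "P n (a + b) = P n a + P n b"
begin

abbreviation "defect \<equiv> morphism_defect (series_prod F) (series_prod G) (fps_lin P)"

lemma P_zero [simp]: "P n 0 = 0"
  using P_add[of n 0 0] by simp

lemma P_series: "t_linear (fps_lin P)"
  by (rule fps_lin_t_linear) (rule P_add)

lemma P_series_add: "fps_lin P (a + b) = fps_lin P a + fps_lin P b"
  using P_series by (simp add: t_linear_def)

lemma defect_const:
  "fps_nth (defect s (fps_const a) (fps_const b)) n = morphism_coeff F G P n s a b"
  by (simp add: morphism_defect_def morphism_coeff_def G.series_prod_nth fps_lin_const)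
    (simp add: fps_lin_def F.series_prod_const)

lemma defect_t_linear: "t_linear (\<lambda>a. defect s a b)" "t_linear (\<lambda>b. defect s a b)"
  unfolding morphism_defect_def
  by (intro t_linear_diff t_linear_compose[OF P_series F.series_prod_t_linear(1)]
      t_linear_compose[OF P_series F.series_prod_t_linear(2)]
      t_linear_compose[OF G.series_prod_t_linear(1) P_series]
      t_linear_compose[OF G.series_prod_t_linear(2) P_series])+

lemma defect_vanish:
  assumes "\<And>m s a b. m < N \<Longrightarrow> morphism_coeff F G P m s a b = 0" and "m < N"
  shows "fps_nth (defect s a b) m = 0"
proof -
  have "fps_nth (defect s (fps_const a) b) m = 0" if "m < N" for m a b
    using defect_t_linear(2) _ that by (rule t_linear_vanish) (simp add: defect_const assms)
  then show ?thesis
    using \<open>m < N\<close> by (rule t_linear_vanish[OF defect_t_linear(1)])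
qed

lemma defect_leading:
  assumes "\<And>m s a b. m < N \<Longrightarrow> morphism_coeff F G P m s a b = 0"
  shows "fps_nth (defect s a b) N = morphism_coeff F G P N s (fps_nth a 0) (fps_nth b 0)"
  using t_linear_leading[OF defect_t_linear(1), of N s b a]
    t_linear_leading[OF defect_t_linear(2), of N s _ b] defect_vanish[OF assms]
  by (simp add: defect_const)

text \<open>As for \<open>assoc_coeff_cocycle\<close>, but from \<open>morphism_pentagon\<close>:
  associators and defects start in degree N, so the surrounding products and the outer map
  contribute only \<open>F 0\<close>, \<open>G 0\<close> and \<open>P 0\<close>.\<close>

lemma morphism_coeff_cocycle:
  assumes F0: "\<And>m y a b c. m < N \<Longrightarrow> y \<in> Y 3 \<Longrightarrow> assoc_coeff F m y a b c = 0"
    and G0: "\<And>m y a b c. m < N \<Longrightarrow> y \<in> Y 3 \<Longrightarrow> assoc_coeff G m y a b c = 0"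
    and P0: "\<And>m s a b. m < N \<Longrightarrow> morphism_coeff F G P m s a b = 0"
    and y: "y \<in> Y 3"
  shows "P 0 (assoc_coeff F N y a b c) - assoc_coeff G N y (P 0 a) (P 0 b) (P 0 c)
    = G 0 (circ 2 y 0) (P 0 a) (morphism_coeff F G P N (side_of (del 0 y)) b c)
    - morphism_coeff F G P N (side_of (del 1 y)) (F 0 (circ 2 y 1) a b) c
    + morphism_coeff F G P N (side_of (del 2 y)) a (F 0 (circ 2 y 2) b c)
    - G 0 (circ 2 y 3) (morphism_coeff F G P N (side_of (del 3 y)) a b) (P 0 c)"
proof -
  have F1: "assoc_coeff F m y a b c = 0" and G1: "assoc_coeff G m y a' b' c' = 0" if "m < N"
    for m a b c a' b' c'
    using F0 G0 y that by blast+
  have vanish: "fps_nth (associator (series_prod F) y u v w) m = 0"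
    and defect_vanish: "fps_nth (defect s u v) m = 0" if "m < N" for m s u v w
    by (rule F.associator_vanish[OF F1 that] defect_vanish[OF P0 that]; assumption)+
  from arg_cong[OF morphism_pentagon[where p = "series_prod F" and a = "fps_const a"
        and b = "fps_const b" and c = "fps_const c", OF G.series.biadditive_axioms P_series_add y],
      of "\<lambda>x. fps_nth x N"]
  show ?thesis
    by (simp add: F.associator_leading[where N = N, OF F1] G.associator_leading[where N = N, OF G1]
        vanish fps_lin_leading fps_lin_const
        G.series_prod_leading_left G.series_prod_leading_right
        defect_vanish defect_leading[where N = N, OF P0] F.series_prod_const)
qed

end


section \<open>Deformations from coefficients\<close>

lemma bilinD:
  assumes "bilin s1 s2 s3 f"
  shows "f (a + a') b = f a b + f a' b" "f a (b + b') = f a b + f a b'"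
    "f (s1 k a) b = s3 k (f a b)" "f a (s2 k b) = s3 k (f a b)"
  using assms by (simp_all add: bilin_def Vector_Spaces.linear_iff)

lemma product_familyI: "(\<And>n s. bilin sc sc sc (F n s)) \<Longrightarrow> product_family F"
  by unfold_locales (auto intro: bilinD(1,2))

lemma morphism_familyI:
  assumes "\<And>n s. bilin s1 s1 s1 (F n s)" and "\<And>n s. bilin s2 s2 s2 (G n s)"
    and "\<And>n. Vector_Spaces.linear s1 s2 (P n)"
  shows "morphism_family F G P"
  using assms
  by (intro morphism_family.intro product_familyI[of s1 F] product_familyI[of s2 G]
      morphism_family_axioms.intro) (simp_all add: Vector_Spaces.linear_iff)

lemma vector_space_fps:
  assumes "vector_space s" shows "vector_space (fps_smul s)"
proof -
  interpret vector_space s by fact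
  show ?thesis
    by unfold_locales
      (simp_all add: fps_smul_def fps_eq_iff scale_right_distrib scale_left_distrib)
qed

lemma bilin_series_prod:
  assumes "vector_space sc" and F: "\<And>n s. bilin sc sc sc (F n s)"
  shows "bilin (fps_smul sc) (fps_smul sc) (fps_smul sc) (series_prod F s)"
proof -
  interpret vector_space sc by fact
  interpret product_family F using F by (rule product_familyI)
  show ?thesis
    unfolding bilin_def Vector_Spaces.linear_iff
    by (simp add: vector_space_fps[OF assms(1)] series.addl series.addr)
      (simp add: fps_eq_iff series_prod_nth fps_smul_def bilinD[OF F] scale_sum_right)
qed

lemma linear_fps_lin:
  assumes P: "\<And>n. Vector_Spaces.linear s1 s2 (P n)"
  shows "Vector_Spaces.linear (fps_smul s1) (fps_smul s2) (fps_lin P)"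
proof -
  have v: "vector_space s1" "vector_space s2"
    using P[of 0] by (simp_all add: Vector_Spaces.linear_iff)
  interpret vector_space s2 by fact
  have "P n (a + b) = P n a + P n b" "P n (s1 k a) = s2 k (P n a)" for n a b k
    using P[of n] by (simp_all add: Vector_Spaces.linear_iff)
  then show ?thesis
    unfolding Vector_Spaces.linear_iff
    by (simp add: vector_space_fps v fps_eq_iff fps_lin_def fps_smul_def sum.distrib scale_sum_right)
qed

section \<open>The dialgebra axioms and the morphism law as vanishing of coefficients\<close>

lemma dialgebra_iff_associators:
  "dialgebra D \<longleftrightarrow> vector_space (smul D) \<and> (\<forall>s. bilin (smul D) (smul D) (smul D) (dprod D s)) \<and>
    (\<forall>y\<in>Y 3. \<forall>a b c. associator (dprod D) y a b c = 0)"
proof -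
  have s: "(\<forall>s. Q s) \<longleftrightarrow> Q Lft \<and> Q Rgt" for Q by (metis side.exhaust)
  show ?thesis
    unfolding dialgebra_def s Y_3
    by (auto simp: associator_def circ_def tree21_def tree12_def dprod_def)
qed

text \<open>The equations between coefficients concern constant series;
  \<open>associator_vanish\<close> carries them over to all of D[[t]].\<close>

lemma dialgebra_deformationI:
  assumes "dialgebra D" and F: "\<And>n s. bilin (smul D) (smul D) (smul D) (F n s)"
    and F_0: "F 0 = dprod D"
    and eq: "\<And>n y a b c. y \<in> Y 3 \<Longrightarrow> assoc_coeff F n y a b c = 0"
  shows "dialgebra_deformation D (\<lambda>n. F n Lft, \<lambda>n. F n Rgt)"
proof -
  interpret dialgebra D by fact
  interpret product_family F using F by (rule product_familyI)
  let ?D = "deformed D (\<lambda>n. F n Lft, \<lambda>n. F n Rgt)"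
  have p: "dprod ?D = series_prod F"
    by (intro ext) (simp add: dprod_def deformed_def series_prod_def split: side.split)
  have "associator (series_prod F) y a b c = 0" if "y \<in> Y 3" for y a b c
    using associator_vanish[OF eq[OF that]] by (simp add: fps_eq_iff) blast
  then have "dialgebra ?D"
    unfolding dialgebra_iff_associators p
    using bilin_series_prod[OF vs F] vector_space_fps[OF vs] by (simp add: deformed_def)
  then show ?thesis
    by (simp add: dialgebra_deformation_def F F_0 dprod_def)
qed

lemma (in dialgebra_morphism) morphism_deformationI:
  assumes F: "\<And>n s. bilin (smul D) (smul D) (smul D) (F n s)"
    and G: "\<And>n s. bilin (smul E) (smul E) (smul E) (G n s)"
    and P: "\<And>n. Vector_Spaces.linear (smul D) (smul E) (P n)"
    and zero: "F 0 = dprod D" "G 0 = dprod E" "P 0 = \<psi>"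
    and F_eq: "\<And>n y a b c. y \<in> Y 3 \<Longrightarrow> assoc_coeff F n y a b c = 0"
    and G_eq: "\<And>n y a b c. y \<in> Y 3 \<Longrightarrow> assoc_coeff G n y a b c = 0"
    and P_eq: "\<And>n s a b. morphism_coeff F G P n s a b = 0"
  shows "morphism_deformation D E \<psi>
    ((\<lambda>n. F n Lft, \<lambda>n. F n Rgt), (\<lambda>n. G n Lft, \<lambda>n. G n Rgt), P)"
proof -
  have dD: "dialgebra_deformation D (\<lambda>n. F n Lft, \<lambda>n. F n Rgt)"
    by (rule dialgebra_deformationI) (use F zero F_eq D.dialgebra_axioms in auto)
  have dE: "dialgebra_deformation E (\<lambda>n. G n Lft, \<lambda>n. G n Rgt)"
    by (rule dialgebra_deformationI) (use G zero G_eq E.dialgebra_axioms in auto)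
  interpret morphism_family F G P
    using F G P by (rule morphism_familyI)
  have "defect s a b = 0" for s a b
    using defect_vanish[OF P_eq] by (simp add: fps_eq_iff) blast
  then have "fps_lin P (series_prod F s a b) = series_prod G s (fps_lin P a) (fps_lin P b)" for s a b
    by (simp add: morphism_defect_def)
  with dD dE show ?thesis
    by (simp add: morphism_deformation_def dialgebra_morphism_def dialgebra_morphism_axioms_def
        dialgebra_deformation_def P zero)
      (simp add: deformed_def series_prod_def linear_fps_lin[OF P])
qed

section \<open>The effect of changing a single coefficient\<close>

lemma sum_split_ends:
  fixes h :: "nat \<Rightarrow> 'a::comm_monoid_add"
  assumes "0 < N"
  shows "(\<Sum>i\<le>N. h i) = h 0 + h N + (\<Sum>i\<in>{0<..<N}. h i)"
proof -
  have "{..N} = insert 0 (insert N {0<..<N})" using assms by auto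
  then show ?thesis using assms by (simp add: add.assoc)
qed

text \<open>The coboundary of a 2-cochain, and the third component of the coboundary of a triple, in terms
  of the products: the first-order changes of the associator and of the multiplicativity defect.\<close>

definition assoc_diff where
  "assoc_diff p f y a b c =
    p (circ 2 y 0) a (f (circ 2 y 2) b c) - f (circ 2 y 3) (p (circ 2 y 1) a b) c
    + f (circ 2 y 0) a (p (circ 2 y 2) b c) - p (circ 2 y 3) (f (circ 2 y 1) a b) c"

definition morphism_diff where
  "morphism_diff p q \<psi> f g h s a b = \<psi> (f s a b) - g s (\<psi> a) (\<psi> b)
    - (q s (\<psi> a) (h b) - h (p s a b) + q s (h a) (\<psi> b))"

text \<open>In the convolution sums of order N the coefficient of index N occurs only in the two end
  terms, each time paired with \<open>F 0\<close>. Since \<open>F N\<close> was zero, the old end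
  terms vanish and the new ones make up \<open>assoc_diff\<close>.\<close>

lemma (in product_family) assoc_coeff_upd:
  assumes "0 < N" and F_N: "F N = 0"
  shows "assoc_coeff (F(N := f)) N y a b c = assoc_coeff F N y a b c
    + assoc_diff (F 0) f y a b c"
proof -
  have "(\<Sum>i\<in>{0<..<N}. h ((F(N := f)) i) ((F(N := f)) (N - i)))
      = (\<Sum>i\<in>{0<..<N}. h (F i) (F (N - i)))" for h :: "_ \<Rightarrow> _ \<Rightarrow> 'a"
    by (rule sum.cong) auto
  note mid = this[of "\<lambda>u v. u (circ 2 y 0) a (v (circ 2 y 2) b c)"]
    this[of "\<lambda>u v. u (circ 2 y 3) (v (circ 2 y 1) a b) c"]
  show ?thesis
    unfolding assoc_coeff_def sum_split_ends[OF \<open>0 < N\<close>] mid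
    using assms by (simp add: assoc_diff_def)
qed

lemma (in morphism_family) morphism_coeff_upd:
  assumes "0 < N" and N: "F N = 0" "G N = 0" "P N = 0"
  shows "morphism_coeff (F(N := f)) (G(N := g)) (P(N := p)) N s a b = morphism_coeff F G P N s a b
    + morphism_diff (F 0) (G 0) (P 0) f g p s a b"
proof -
  let ?F = "F(N := f)" and ?G = "G(N := g)" and ?P = "P(N := p)"
  have 1: "(\<Sum>i\<in>{0<..<N}. ?P i (?F (N - i) s a b)) = (\<Sum>i\<in>{0<..<N}. P i (F (N - i) s a b))"
    by (rule sum.cong) auto
  have 2: "(\<Sum>i\<in>{0<..<N}. \<Sum>j\<le>N - i. ?G i s (?P j a) (?P (N - i - j) b))
      = (\<Sum>i\<in>{0<..<N}. \<Sum>j\<le>N - i. G i s (P j a) (P (N - i - j) b))"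
    by (rule sum.cong[OF refl], rule sum.cong[OF refl]) auto
  \<comment> \<open>The end term i = 0 of the double sum is itself a convolution, of two
    coefficients of the map under \<open>G 0\<close>; here too the new coefficient \<open>p\<close>
    enters only at the ends.\<close>
  have 3: "(\<Sum>j\<in>{0<..<N}. G 0 s (P j a) ((if N - j = N then p else P (N - j)) b))
      = (\<Sum>j\<in>{0<..<N}. G 0 s (P j a) (P (N - j) b))"
    by (rule sum.cong) auto
  show ?thesis
    unfolding morphism_coeff_def sum_split_ends[OF \<open>0 < N\<close>] diff_zero 1 2
    using assms by (simp add: 3 assoc_diff_def morphism_diff_def)
qed

lemma assoc_coeff_cong:
  assumes "\<And>m. m \<le> n \<Longrightarrow> F m = G m"
  shows "assoc_coeff F n = assoc_coeff G n"
  by (intro ext) (simp add: assoc_coeff_def assms)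

lemma morphism_coeff_cong:
  assumes "\<And>m. m \<le> n \<Longrightarrow> F m = F' m" "\<And>m. m \<le> n \<Longrightarrow> G m = G' m" "\<And>m. m \<le> n \<Longrightarrow> P m = P' m"
  shows "morphism_coeff F G P n = morphism_coeff F' G' P' n"
  by (intro ext) (simp add: morphism_coeff_def assms)


section \<open>Cochains of low degree\<close>

lemma delta_1:
  assumes "vector_space (msmul M)" and "y \<in> Y 2"
  shows "delta D M 1 f y [a, b] = lact M (circ 1 y 0) a (f (del 0 y) [b])
    - f (del 1 y) [dprod D (circ 1 y 1) a b] + ract M (circ 1 y 2) (f (del 2 y) [a]) b"
proof -
  interpret vector_space "msmul M" by fact
  have "{..Suc (Suc 0)} = {0, 1, 2}" by auto
  with \<open>y \<in> Y 2\<close> show ?thesis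
    by (simp add: delta_def coface_def numeral_2_eq_2)
qed

lemma delta_2:
  assumes "vector_space (msmul M)" and "y \<in> Y 3"
  shows "delta D M 2 f y [a, b, c] = lact M (circ 2 y 0) a (f (del 0 y) [b, c])
    - f (del 1 y) [dprod D (circ 2 y 1) a b, c] + f (del 2 y) [a, dprod D (circ 2 y 2) b c]
    - ract M (circ 2 y 3) (f (del 3 y) [a, b]) c"
proof -
  interpret vector_space "msmul M" by fact
  have "{..3} = {0, 1, 2, 3::nat}" by auto
  with \<open>y \<in> Y 3\<close> show ?thesis
    by (simp add: delta_def coface_def)
qed

lemma delta_3:
  assumes "vector_space (msmul M)" and "y \<in> Y 4"
  shows "delta D M 3 f y [a, b, c, d] = lact M (circ 3 y 0) a (f (del 0 y) [b, c, d])
    - f (del 1 y) [dprod D (circ 3 y 1) a b, c, d] + f (del 2 y) [a, dprod D (circ 3 y 2) b c, d]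
    - f (del 3 y) [a, b, dprod D (circ 3 y 3) c d] + ract M (circ 3 y 4) (f (del 4 y) [a, b, c]) d"
proof -
  interpret vector_space "msmul M" by fact
  have "{..4} = {0, 1, 2, 3, 4::nat}" by auto
  with \<open>y \<in> Y 4\<close> show ?thesis
    by (simp add: delta_def coface_def)
qed

section \<open>Passage between cochains and products\<close>

definition tree_of :: "side \<Rightarrow> tree"
  where "tree_of s = (case s of Lft \<Rightarrow> tree21 | Rgt \<Rightarrow> tree12)"

lemma side_of_tree_of [simp]: "side_of (tree_of s) = s"
  by (cases s) (simp_all add: tree_of_def side_of_def tree21_def tree12_def)

lemma tree_of_side_of: "y \<in> Y 2 \<Longrightarrow> tree_of (side_of y) = y"
  by (auto simp: Y_2 tree_of_def side_of_def tree21_def tree12_def)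

lemma tree_of_in_Y: "tree_of s \<in> Y 2"
  by (cases s) (simp_all add: tree_of_def Y_2)

text \<open>Hence the coboundary of a 1-cochain measures, for each symbol separately, the failure of
  a map to be a derivation.\<close>

lemma circ_1:
  assumes "y \<in> Y 2"
  shows "circ 1 y 0 = side_of y" "circ 1 y 1 = side_of y" "circ 1 y 2 = side_of y"
  using assms by (auto simp: Y_2 circ_def side_of_def tree21_def tree12_def)

lemma del_eq_tree_of:
  assumes "y \<in> Y 3"
  shows "del 0 y = tree_of (circ 2 y 2)" "del 1 y = tree_of (circ 2 y 3)"
    "del 2 y = tree_of (circ 2 y 0)" "del 3 y = tree_of (circ 2 y 1)"
proof -
  have "del i y \<in> Y 2" for i using del_in_Y[of y 2] assms by simp
  then show "del 0 y = tree_of (circ 2 y 2)" "del 1 y = tree_of (circ 2 y 3)"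
    "del 2 y = tree_of (circ 2 y 0)" "del 3 y = tree_of (circ 2 y 1)"
    using side_of_del[OF assms] tree_of_side_of by metis+
qed

text \<open>Extension by zero to arguments of the wrong size gives the normalised form required by
  \<open>CY\<close>.\<close>

definition bicochain :: "(side \<Rightarrow> 'a \<Rightarrow> 'a \<Rightarrow> 'b::zero) \<Rightarrow> ('a, 'b) cochain"
  where "bicochain T y xs = (if y \<in> Y 2 \<and> length xs = 2 then T (side_of y) (xs ! 0) (xs ! 1) else 0)"

definition tricochain :: "(tree \<Rightarrow> 'a \<Rightarrow> 'a \<Rightarrow> 'a \<Rightarrow> 'b::zero) \<Rightarrow> ('a, 'b) cochain"
  where "tricochain T y xs =
    (if y \<in> Y 3 \<and> length xs = 3 then T y (xs ! 0) (xs ! 1) (xs ! 2) else 0)"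

lemma bicochain_in_CY:
  assumes "\<And>s. bilin (smul D) (smul D) (msmul M) (T s)"
  shows "bicochain T \<in> CY D M 2"
  using assms by (auto simp: CY_def bicochain_def bilin_def less_2_cases_iff)

lemma tricochain_in_CY:
  assumes "\<And>y b c. Vector_Spaces.linear (smul D) (msmul M) (\<lambda>a. T y a b c)"
    and "\<And>y a c. Vector_Spaces.linear (smul D) (msmul M) (\<lambda>b. T y a b c)"
    and "\<And>y a b. Vector_Spaces.linear (smul D) (msmul M) (\<lambda>c. T y a b c)"
  shows "tricochain T \<in> CY D M 3"
proof -
  have "i < 3 \<longleftrightarrow> i = 0 \<or> i = 1 \<or> i = 2" for i :: nat by auto
  then show ?thesis
    using assms by (auto simp: CY_def tricochain_def)
qed

lemma bilin_CY_2:
  assumes "f \<in> CY D M 2"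
  shows "bilin (smul D) (smul D) (msmul M) (\<lambda>a b. f (tree_of s) [a, b])"
proof -
  have "Vector_Spaces.linear (smul D) (msmul M) (\<lambda>x. f (tree_of s) ([a, b][i := x]))" if "i < 2" for a b i
    using assms tree_of_in_Y[of s] that unfolding CY_def by (auto simp del: list_update.simps)
  from this[of 0] this[of 1] show ?thesis
    by (simp add: bilin_def)
qed

lemma linear_CY_1:
  assumes "f \<in> CY D M 1"
  shows "Vector_Spaces.linear (smul D) (msmul M) (\<lambda>a. f (Leaf \<or>\<^sub>t Leaf) [a])"
proof -
  have "Leaf \<or>\<^sub>t Leaf \<in> Y 1" using Y_1 by simp
  \<comment> \<open>The entry 0 is a placeholder that the update overwrites.\<close>
  then have "Vector_Spaces.linear (smul D) (msmul M) (\<lambda>x. f (Leaf \<or>\<^sub>t Leaf) ([0][0 := x]))"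
    using assms unfolding CY_def by (auto simp del: list_update.simps)
  then show ?thesis by simp
qed

lemma length_2: "length xs = 2 \<longleftrightarrow> (\<exists>a b. xs = [a, b])"
  by (auto simp: numeral_2_eq_2 length_Suc_conv)

text \<open>Normalisation of cochains turns agreement on 2-trees and pairs into equality of
  functions, so the infinitesimal will be the given cocycle itself.\<close>

lemma cochain2_eq:
  assumes "f \<in> CY D M 2"
  shows "cochain2 (\<lambda>a b. f (tree_of Lft) [a, b]) (\<lambda>a b. f (tree_of Rgt) [a, b]) = f"
proof (intro ext)
  fix y xs
  show "cochain2 (\<lambda>a b. f (tree_of Lft) [a, b]) (\<lambda>a b. f (tree_of Rgt) [a, b]) y xs = f y xs"
  proof (cases "y \<in> Y 2 \<and> length xs = 2")
    case True
    then obtain a b where "xs = [a, b]" by (auto simp: length_2)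
    with True show ?thesis
      by (auto simp: cochain2_def tree_of_def Y_2 tree21_def tree12_def)
  next
    case False
    then have "f y xs = 0" using assms unfolding CY_def by blast
    with False show ?thesis by (auto simp: cochain2_def Y_2)
  qed
qed

lemma cochain1_eq:
  assumes "f \<in> CY D M 1"
  shows "cochain1 (\<lambda>a. f (Leaf \<or>\<^sub>t Leaf) [a]) = f"
proof (intro ext)
  fix y xs
  show "cochain1 (\<lambda>a. f (Leaf \<or>\<^sub>t Leaf) [a]) y xs = f y xs"
  proof (cases "y \<in> Y 1 \<and> length xs = 1")
    case True
    then obtain a where "xs = [a]" by (auto simp: length_Suc_conv)
    with True Y_1 show ?thesis by (simp add: cochain1_def)
  next
    case False
    then have "f y xs = 0" using assms unfolding CY_def by blast
    with False Y_1 show ?thesis by (auto simp: cochain1_def)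
  qed
qed

text \<open>The four cofaces replace, one at a time, the four products in the associator by the
  cochain. By \<open>del_eq_tree_of\<close> the face tree carries the symbol of the product that is
  replaced.\<close>

lemma (in dialgebra) delta_2_eq_assoc_diff:
  assumes "y \<in> Y 3"
  shows "delta D (self_rep D) 2 f y [a, b, c]
    = assoc_diff (dprod D) (\<lambda>s a b. f (tree_of s) [a, b]) y a b c"
  using assms vs
  by (simp add: delta_2 self_rep_def assoc_diff_def del_eq_tree_of(1,3,4)
      del_eq_tree_of(2)[unfolded One_nat_def])

lemma (in dialgebra_morphism) third_component_eq_morphism_diff:
  "\<psi> (\<xi> (tree_of s) [a, b]) - \<pi> (tree_of s) [\<psi> a, \<psi> b] - delta D (rep_via \<psi> E) 1 \<phi> (tree_of s) [a, b]
    = morphism_diff (dprod D) (dprod E) \<psi> (\<lambda>s a b. \<xi> (tree_of s) [a, b])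
        (\<lambda>s a b. \<pi> (tree_of s) [a, b]) (\<lambda>a. \<phi> (Leaf \<or>\<^sub>t Leaf) [a]) s a b"
proof -
  \<comment> \<open>There is only one 1-tree, so a 1-cochain is a single linear map.\<close>
  have "del i (tree_of s) = Leaf \<or>\<^sub>t Leaf" for i
    using del_in_Y[of "tree_of s" 1 i] tree_of_in_Y[of s] Y_1 by (simp add: numeral_2_eq_2)
  then show ?thesis
    using delta_1[of "rep_via \<psi> E" "tree_of s" D \<phi> a b] E.vs tree_of_in_Y[of s]
      circ_1[OF tree_of_in_Y[of s]]
    by (simp add: rep_via_def morphism_diff_def)
qed

section \<open>The obstruction as a cochain\<close>

lemma linear_assoc_coeff:
  assumes "vector_space sc" and F: "\<And>n s. bilin sc sc sc (F n s)"
  shows "Vector_Spaces.linear sc sc (\<lambda>a. assoc_coeff F n y a b c)"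
    and "Vector_Spaces.linear sc sc (\<lambda>b. assoc_coeff F n y a b c)"
    and "Vector_Spaces.linear sc sc (\<lambda>c. assoc_coeff F n y a b c)"
proof -
  interpret vector_space sc by fact
  show "Vector_Spaces.linear sc sc (\<lambda>a. assoc_coeff F n y a b c)"
    "Vector_Spaces.linear sc sc (\<lambda>b. assoc_coeff F n y a b c)"
    "Vector_Spaces.linear sc sc (\<lambda>c. assoc_coeff F n y a b c)"
    unfolding Vector_Spaces.linear_iff assoc_coeff_def
    by (simp_all add: assms(1) bilinD[OF F] sum.distrib scale_sum_right scale_right_diff_distrib)
qed

lemma bilin_morphism_coeff:
  assumes vs: "vector_space s1" "vector_space s2"
    and F: "\<And>n s. bilin s1 s1 s1 (F n s)" and G: "\<And>n s. bilin s2 s2 s2 (G n s)"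
    and P: "\<And>n. Vector_Spaces.linear s1 s2 (P n)"
  shows "bilin s1 s1 s2 (morphism_coeff F G P n s)"
proof -
  interpret vector_space s2 by fact
  have [simp]: "P n (a + b) = P n a + P n b" "P n (s1 k a) = s2 k (P n a)" for n a b k
    using P[of n] by (simp_all add: Vector_Spaces.linear_iff)
  show ?thesis
    unfolding bilin_def Vector_Spaces.linear_iff morphism_coeff_def
    by (simp add: vs bilinD[OF F] bilinD[OF G] sum.distrib scale_sum_right scale_right_diff_distrib)
qed

lemma vector_space_scale:
  assumes "vector_space s" shows "s k 0 = 0" "s k (- a) = - s k a"
proof -
  interpret vector_space s by fact
  show "s k 0 = 0" "s k (- a) = - s k a" by simp_all
qed

lemma linear_uminus:
  "Vector_Spaces.linear s1 s2 f \<Longrightarrow> Vector_Spaces.linear s1 s2 (\<lambda>a. - f a)"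
  by (simp add: Vector_Spaces.linear_iff vector_space_scale)

lemma bilin_uminus: "bilin s1 s2 s3 f \<Longrightarrow> bilin s1 s2 s3 (\<lambda>a b. - f a b)"
  by (simp add: bilin_def linear_uminus)

lemma length_3: "length xs = 3 \<longleftrightarrow> (\<exists>a b c. xs = [a, b, c])"
  by (auto simp: numeral_3_eq_3 length_Suc_conv)

lemma length_4: "length xs = 4 \<longleftrightarrow> (\<exists>a b c d. xs = [a, b, c, d])"
  by (auto simp: eval_nat_numeral length_Suc_conv)

text \<open>The minus sign anticipates the equation to be solved: the coboundary of the new
  coefficient must cancel the obstruction.\<close>

lemma (in dialgebra) tricochain_cocycle:
  assumes F: "\<And>n s. bilin (smul D) (smul D) (smul D) (F n s)" and F_0: "F 0 = dprod D"
    and eq: "\<And>m y a b c. m < N \<Longrightarrow> y \<in> Y 3 \<Longrightarrow> assoc_coeff F m y a b c = 0"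
  shows "delta D (self_rep D) 3 (tricochain (\<lambda>y a b c. - assoc_coeff F N y a b c)) = 0"
proof (intro ext)
  interpret product_family F using F by (rule product_familyI)
  fix y xs
  let ?o = "tricochain (\<lambda>y a b c. - assoc_coeff F N y a b c)"
  show "delta D (self_rep D) 3 ?o y xs = 0 y xs"
  proof (cases "y \<in> Y 4 \<and> length xs = 4")
    case True
    then obtain a b c d where xs: "xs = [a, b, c, d]" by (auto simp: length_4)
    have "del i y \<in> Y 3" for i using del_in_Y[of y 3] True by simp
    then have [simp]: "?o (del i y) [a, b, c] = - assoc_coeff F N (del i y) a b c" for i a b c
      by (simp add: tricochain_def)
    show ?thesis
      using assoc_coeff_cocycle[OF eq, of N y a b c d] True vs
      by (simp add: xs delta_3 self_rep_def F_0[symmetric] coeff.minusl coeff.minusr)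
        (simp add: algebra_simps)
  qed (auto simp: delta_def)
qed

text \<open>In a trivial quotient every coset B + c equals B. As 0 lies in B, the element c = 0 + c
  lies in B + c and hence in B.\<close>

lemma trivial_HY_imp_coboundary:
  assumes "trivial_group (HY D E \<psi> n)" and "c \<in> ZYm D E \<psi> n" and "0 \<in> BYm D E \<psi> n"
  shows "c \<in> BYm D E \<psi> n"
proof -
  let ?G = "\<lparr>carrier = ZYm D E \<psi> n, monoid.mult = (+), one = 0\<rparr>"
  have "(\<lambda>x. BYm D E \<psi> n #>\<^bsub>?G\<^esub> x) ` ZYm D E \<psi> n = {BYm D E \<psi> n}"
    using assms(1) by (simp add: trivial_group_def HY_def carrier_FactGroup)
  with assms(2) have "BYm D E \<psi> n #>\<^bsub>?G\<^esub> c = BYm D E \<psi> n" by blast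
  moreover have "0 + c \<in> BYm D E \<psi> n #>\<^bsub>?G\<^esub> c"
    using assms(3) by (auto simp: r_coset_def)
  ultimately show ?thesis by simp
qed

section \<open>Solving the obstruction equation when the cohomology vanishes\<close>

context dialgebra_morphism
begin

lemma psi_add: "\<psi> (a + b) = \<psi> a + \<psi> b"
  using lin by (simp add: Vector_Spaces.linear_iff)

lemma psi_zero [simp]: "\<psi> 0 = 0"
  using psi_add[of 0 0] by simp

lemma zero_in_CY:
  assumes "vector_space (smul D')" "vector_space (msmul M)"
  shows "0 \<in> CY D' M n"
  using assms vector_space_scale(1)[of "msmul M"]
  by (auto simp: CY_def Vector_Spaces.linear_iff)

lemma dprod_zero:
  "dprod D s a 0 = 0" "dprod D s 0 a = 0" "dprod E s b 0 = 0" "dprod E s 0 b = 0"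
  using bilinD(1)[OF D.lprod_bilin, of 0 0] bilinD(2)[OF D.lprod_bilin, of _ 0 0]
      bilinD(1)[OF D.rprod_bilin, of 0 0] bilinD(2)[OF D.rprod_bilin, of _ 0 0]
      bilinD(1)[OF E.lprod_bilin, of 0 0] bilinD(2)[OF E.lprod_bilin, of _ 0 0]
      bilinD(1)[OF E.rprod_bilin, of 0 0] bilinD(2)[OF E.rprod_bilin, of _ 0 0]
  by (cases s; simp add: dprod_def)+

lemma zero_in_BYm: "0 \<in> BYm D E \<psi> 3"
proof -
  have v: "vector_space (msmul (self_rep D))" "vector_space (msmul (self_rep E))"
    "vector_space (msmul (rep_via \<psi> E))"
    by (simp_all add: self_rep_def rep_via_def D.vs E.vs)
  have "(0, 0, 0) \<in> CYm D E \<psi> 2"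
    by (simp add: CYm_def zero_in_CY v D.vs E.vs)
  moreover have "deltam D E \<psi> 2 (0, 0, 0) = 0"
  proof -
    have "delta D (self_rep D) n 0 = 0" "delta E (self_rep E) n 0 = 0"
      "delta D (rep_via \<psi> E) n 0 = 0" for n
      using v[THEN vector_space_scale(1)] dprod_zero
      by (intro ext; simp add: delta_def coface_def rep_via_def self_rep_def cong: if_cong)+
    then show ?thesis by (simp add: deltam_def zero_prod_def) (simp add: fun_eq_iff)
  qed
  ultimately show ?thesis
    by (simp add: BYm_def image_iff) metis
qed

text \<open>The negated coefficients of order N form a 3-cocycle, hence a coboundary. The formulas
  for the coboundary in low degree turn a 2-cochain bounding it into the required products and
  map.\<close>

lemma obstruction_vanishes:
  assumes HY: "trivial_group (HY D E \<psi> 3)"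
    and F: "\<And>n s. bilin (smul D) (smul D) (smul D) (F n s)"
    and G: "\<And>n s. bilin (smul E) (smul E) (smul E) (G n s)"
    and P: "\<And>n. Vector_Spaces.linear (smul D) (smul E) (P n)"
    and zero: "F 0 = dprod D" "G 0 = dprod E" "P 0 = \<psi>"
    and F_eq: "\<And>m y a b c. m < N \<Longrightarrow> y \<in> Y 3 \<Longrightarrow> assoc_coeff F m y a b c = 0"
    and G_eq: "\<And>m y a b c. m < N \<Longrightarrow> y \<in> Y 3 \<Longrightarrow> assoc_coeff G m y a b c = 0"
    and P_eq: "\<And>m s a b. m < N \<Longrightarrow> morphism_coeff F G P m s a b = 0"
  obtains f g h where "\<And>s. bilin (smul D) (smul D) (smul D) (f s)"
    and "\<And>s. bilin (smul E) (smul E) (smul E) (g s)"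
    and "Vector_Spaces.linear (smul D) (smul E) h"
    and "\<And>y a b c. y \<in> Y 3 \<Longrightarrow> assoc_diff (dprod D) f y a b c = - assoc_coeff F N y a b c"
    and "\<And>y a b c. y \<in> Y 3 \<Longrightarrow> assoc_diff (dprod E) g y a b c = - assoc_coeff G N y a b c"
    and "\<And>s a b. morphism_diff (dprod D) (dprod E) \<psi> f g h s a b = - morphism_coeff F G P N s a b"
proof -
  interpret morphism_family F G P
    using F G P by (rule morphism_familyI)
  let ?\<xi> = "tricochain (\<lambda>y a b c. - assoc_coeff F N y a b c)"
  let ?\<pi> = "tricochain (\<lambda>y a b c. - assoc_coeff G N y a b c)"
  let ?\<phi> = "bicochain (\<lambda>s a b. - morphism_coeff F G P N s a b)"
  \<comment> \<open>Up to the overall sign this is \<open>morphism_coeff_cocycle\<close>, whose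
    right-hand side is the coboundary of the 2-cochain formed by the defects.\<close>
  have third: "\<psi> (?\<xi> y xs) - ?\<pi> y (map \<psi> xs) - delta D (rep_via \<psi> E) 2 ?\<phi> y xs = 0" for y xs
  proof (cases "y \<in> Y 3 \<and> length xs = 3")
    case True
    then obtain a b c where xs: "xs = [a, b, c]" and y: "y \<in> Y 3" by (auto simp: length_3)
    have "del i y \<in> Y 2" for i using del_in_Y[of y 2] y by simp
    then have [simp]: "?\<phi> (del i y) [a, b] = - morphism_coeff F G P N (side_of (del i y)) a b" for i a b
      by (simp add: bicochain_def)
    have "\<psi> (- a) = - \<psi> a" for a
      using psi_add[of a "- a"] by (simp add: eq_neg_iff_add_eq_0 add.commute)
    then show ?thesis
      using morphism_coeff_cocycle[OF F_eq G_eq P_eq y, of N a b c] E.vs y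
      by (simp add: xs delta_2 rep_via_def zero[symmetric] G.coeff.minusl G.coeff.minusr tricochain_def)
        (simp add: algebra_simps)
  qed (auto simp: tricochain_def delta_def)
  have "(?\<xi>, ?\<pi>, ?\<phi>) \<in> CYm D E \<psi> 3"
    unfolding CYm_def
    using bilin_uminus[OF bilin_morphism_coeff[OF D.vs E.vs F G P]]
      linear_uminus[OF linear_assoc_coeff(1)[OF D.vs F]]
      linear_uminus[OF linear_assoc_coeff(2)[OF D.vs F]]
      linear_uminus[OF linear_assoc_coeff(3)[OF D.vs F]]
      linear_uminus[OF linear_assoc_coeff(1)[OF E.vs G]]
      linear_uminus[OF linear_assoc_coeff(2)[OF E.vs G]]
      linear_uminus[OF linear_assoc_coeff(3)[OF E.vs G]]
    by (simp add: tricochain_in_CY bicochain_in_CY self_rep_def rep_via_def)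
  moreover have "deltam D E \<psi> 3 (?\<xi>, ?\<pi>, ?\<phi>) = 0"
  proof -
    have "deltam D E \<psi> 3 (?\<xi>, ?\<pi>, ?\<phi>) = (delta D (self_rep D) 3 ?\<xi>, delta E (self_rep E) 3 ?\<pi>,
        \<lambda>y xs. \<psi> (?\<xi> y xs) - ?\<pi> y (map \<psi> xs) - delta D (rep_via \<psi> E) 2 ?\<phi> y xs)"
      by (simp add: deltam_def)
    also have "\<dots> = (0, 0, \<lambda>y xs. 0)"
      by (simp only: third D.tricochain_cocycle[OF F zero(1) F_eq]
          E.tricochain_cocycle[OF G zero(2) G_eq])
    finally show ?thesis by (simp add: zero_prod_def zero_fun_def)
  qed
  ultimately have "(?\<xi>, ?\<pi>, ?\<phi>) \<in> BYm D E \<psi> 3"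
    by (intro trivial_HY_imp_coboundary[OF HY _ zero_in_BYm]) (simp add: ZYm_def)
  then obtain \<xi> \<pi> \<phi> where c: "(\<xi>, \<pi>, \<phi>) \<in> CYm D E \<psi> 2"
    and d: "(?\<xi>, ?\<pi>, ?\<phi>) = deltam D E \<psi> 2 (\<xi>, \<pi>, \<phi>)"
    unfolding BYm_def by auto
  from d have d1: "?\<xi> = delta D (self_rep D) 2 \<xi>" and d2: "?\<pi> = delta E (self_rep E) 2 \<pi>"
    and d3: "?\<phi> = (\<lambda>y xs. \<psi> (\<xi> y xs) - \<pi> y (map \<psi> xs) - delta D (rep_via \<psi> E) 1 \<phi> y xs)"
    by (simp_all add: deltam_def)
  \<comment> \<open>The witnesses are the values of this 2-cochain on the trees [21] and [12] and on
    the single 1-tree.\<close>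
  show thesis
  proof
    show "bilin (smul D) (smul D) (smul D) (\<lambda>a b. \<xi> (tree_of s) [a, b])" for s
      using c bilin_CY_2[of \<xi> D "self_rep D" s] by (simp add: CYm_def self_rep_def)
    show "bilin (smul E) (smul E) (smul E) (\<lambda>a b. \<pi> (tree_of s) [a, b])" for s
      using c bilin_CY_2[of \<pi> E "self_rep E" s] by (simp add: CYm_def self_rep_def)
    show "Vector_Spaces.linear (smul D) (smul E) (\<lambda>a. \<phi> (Leaf \<or>\<^sub>t Leaf) [a])"
      using c linear_CY_1[of \<phi> D "rep_via \<psi> E"] by (simp add: CYm_def rep_via_def)
    show "assoc_diff (dprod D) (\<lambda>s a b. \<xi> (tree_of s) [a, b]) y a b c = - assoc_coeff F N y a b c"
      if "y \<in> Y 3" for y a b c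
      using fun_cong[OF fun_cong[OF d1, of y], of "[a, b, c]"] that
      by (simp add: D.delta_2_eq_assoc_diff tricochain_def)
    show "assoc_diff (dprod E) (\<lambda>s a b. \<pi> (tree_of s) [a, b]) y a b c = - assoc_coeff G N y a b c"
      if "y \<in> Y 3" for y a b c
      using fun_cong[OF fun_cong[OF d2, of y], of "[a, b, c]"] that
      by (simp add: E.delta_2_eq_assoc_diff tricochain_def)
    show "morphism_diff (dprod D) (dprod E) \<psi> (\<lambda>s a b. \<xi> (tree_of s) [a, b])
        (\<lambda>s a b. \<pi> (tree_of s) [a, b]) (\<lambda>a. \<phi> (Leaf \<or>\<^sub>t Leaf) [a]) s a b
      = - morphism_coeff F G P N s a b" for s a b
      using fun_cong[OF fun_cong[OF d3, of "tree_of s"], of "[a, b]"]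
      by (simp add: third_component_eq_morphism_diff[unfolded One_nat_def] bicochain_def tree_of_in_Y)
  qed
qed

end


section \<open>Construction of the deformation\<close>

context dialgebra_morphism
begin

text \<open>Such a triple plays the part of \<theta>_n: it is an element of the deformation complex
  in degree 2, written as two families of products and a map.\<close>

definition is_coefficient where
  "is_coefficient r \<longleftrightarrow> (\<forall>s::side. bilin (smul D) (smul D) (smul D) (fst r s)) \<and>
    (\<forall>s::side. bilin (smul E) (smul E) (smul E) (fst (snd r) s)) \<and>
    Vector_Spaces.linear (smul D) (smul E) (snd (snd r))"

definition satisfies_order where
  "satisfies_order \<theta> n \<longleftrightarrow>
    (\<forall>y\<in>Y 3. \<forall>a b c. assoc_coeff (\<lambda>i. fst (\<theta> i)) n y a b c = 0) \<and>
    (\<forall>y\<in>Y 3. \<forall>a b c. assoc_coeff (\<lambda>i. fst (snd (\<theta> i))) n y a b c = 0) \<and>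
    (\<forall>s a b. morphism_coeff (\<lambda>i. fst (\<theta> i)) (\<lambda>i. fst (snd (\<theta> i))) (\<lambda>i. snd (snd (\<theta> i))) n s a b = 0)"

text \<open>This locality permits the choice of coefficients by recursion: later choices cannot
  spoil an equation already satisfied.\<close>

lemma satisfies_order_cong:
  assumes "\<And>m. m \<le> n \<Longrightarrow> \<theta> m = \<theta>' m"
  shows "satisfies_order \<theta> n \<longleftrightarrow> satisfies_order \<theta>' n"
proof -
  have "assoc_coeff (\<lambda>i. fst (\<theta> i)) n = assoc_coeff (\<lambda>i. fst (\<theta>' i)) n"
    "assoc_coeff (\<lambda>i. fst (snd (\<theta> i))) n = assoc_coeff (\<lambda>i. fst (snd (\<theta>' i))) n"
    "morphism_coeff (\<lambda>i. fst (\<theta> i)) (\<lambda>i. fst (snd (\<theta> i))) (\<lambda>i. snd (snd (\<theta> i))) n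
      = morphism_coeff (\<lambda>i. fst (\<theta>' i)) (\<lambda>i. fst (snd (\<theta>' i))) (\<lambda>i. snd (snd (\<theta>' i))) n"
    by (intro assoc_coeff_cong morphism_coeff_cong; simp add: assms)+
  then show ?thesis by (simp add: satisfies_order_def)
qed

lemma bilin_dprod:
  "bilin (smul D) (smul D) (smul D) (dprod D s)" "bilin (smul E) (smul E) (smul E) (dprod E s)"
  using D.dialgebra_axioms E.dialgebra_axioms by (simp_all add: dialgebra_iff_associators)

lemma satisfies_order_0:
  assumes "\<theta> 0 = (dprod D, dprod E, \<psi>)"
  shows "satisfies_order \<theta> 0"
proof -
  have "\<forall>y\<in>Y 3. \<forall>a b c. associator (dprod D) y a b c = 0"
    "\<forall>y\<in>Y 3. \<forall>a b c. associator (dprod E) y a b c = 0"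
    using D.dialgebra_axioms E.dialgebra_axioms by (simp_all add: dialgebra_iff_associators)
  moreover have "\<psi> (dprod D s a b) = dprod E s (\<psi> a) (\<psi> b)" for s a b
    by (cases s) (simp_all add: dprod_def hom_lprod hom_rprod)
  ultimately show ?thesis
    by (simp add: satisfies_order_def assms assoc_coeff_def morphism_coeff_def associator_def)
qed

lemma is_coefficient_0: "is_coefficient 0"
  by (simp add: is_coefficient_def bilin_def Vector_Spaces.linear_iff D.vs E.vs
      vector_space_scale zero_prod_def)

text \<open>The equations of order N are affine in the coefficient of index N: the constant part is
  the obstruction from the earlier coefficients, the linear part is the coboundary.\<close>

lemma satisfies_order_upd_iff:
  assumes \<theta>: "\<And>n. is_coefficient (\<theta> n)" "\<theta> 0 = (dprod D, dprod E, \<psi>)" "\<theta> N = 0" and "0 < N"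
  shows "satisfies_order (\<theta>(N := (f, g, h))) N \<longleftrightarrow>
    (\<forall>y\<in>Y 3. \<forall>a b c. assoc_coeff (\<lambda>i. fst (\<theta> i)) N y a b c + assoc_diff (dprod D) f y a b c = 0) \<and>
    (\<forall>y\<in>Y 3. \<forall>a b c. assoc_coeff (\<lambda>i. fst (snd (\<theta> i))) N y a b c + assoc_diff (dprod E) g y a b c = 0) \<and>
    (\<forall>s a b. morphism_coeff (\<lambda>i. fst (\<theta> i)) (\<lambda>i. fst (snd (\<theta> i))) (\<lambda>i. snd (snd (\<theta> i))) N s a b
      + morphism_diff (dprod D) (dprod E) \<psi> f g h s a b = 0)"
proof -
  let ?F = "\<lambda>i. fst (\<theta> i)" and ?G = "\<lambda>i. fst (snd (\<theta> i))" and ?P = "\<lambda>i. snd (snd (\<theta> i))"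
  interpret morphism_family ?F ?G ?P
    by (rule morphism_familyI[of "smul D" _ "smul E"])
      (use \<theta>(1) in \<open>auto simp: is_coefficient_def\<close>)
  have upd: "(\<lambda>i. fst ((\<theta>(N := (f, g, h))) i)) = ?F(N := f)"
    "(\<lambda>i. fst (snd ((\<theta>(N := (f, g, h))) i))) = ?G(N := g)"
    "(\<lambda>i. snd (snd ((\<theta>(N := (f, g, h))) i))) = ?P(N := h)"
    by auto
  show ?thesis
    unfolding satisfies_order_def upd
    by (simp add: F.assoc_coeff_upd G.assoc_coeff_upd morphism_coeff_upd \<theta> \<open>0 < N\<close>)
qed

lemma extend_deformation:
  assumes HY: "trivial_group (HY D E \<psi> 3)"
    and \<theta>: "\<And>n. is_coefficient (\<theta> n)" "\<theta> 0 = (dprod D, dprod E, \<psi>)" "\<theta> N = 0" and "0 < N"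
    and eq: "\<And>m. m < N \<Longrightarrow> satisfies_order \<theta> m"
  obtains r where "is_coefficient r" "satisfies_order (\<theta>(N := r)) N"
proof -
  obtain f g h where "\<And>s. bilin (smul D) (smul D) (smul D) (f s)"
    and "\<And>s. bilin (smul E) (smul E) (smul E) (g s)"
    and "Vector_Spaces.linear (smul D) (smul E) h"
    and "\<And>y a b c. y \<in> Y 3 \<Longrightarrow> assoc_diff (dprod D) f y a b c = - assoc_coeff (\<lambda>i. fst (\<theta> i)) N y a b c"
    and "\<And>y a b c. y \<in> Y 3 \<Longrightarrow> assoc_diff (dprod E) g y a b c = - assoc_coeff (\<lambda>i. fst (snd (\<theta> i))) N y a b c"
    and "\<And>s a b. morphism_diff (dprod D) (dprod E) \<psi> f g h s a b
      = - morphism_coeff (\<lambda>i. fst (\<theta> i)) (\<lambda>i. fst (snd (\<theta> i))) (\<lambda>i. snd (snd (\<theta> i))) N s a b"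
    by (rule obstruction_vanishes[OF HY, of "\<lambda>i. fst (\<theta> i)" "\<lambda>i. fst (snd (\<theta> i))" "\<lambda>i. snd (snd (\<theta> i))" N])
      (use \<theta> eq in \<open>auto simp: is_coefficient_def satisfies_order_def\<close>)
  then have "is_coefficient (f, g, h)" "satisfies_order (\<theta>(N := (f, g, h))) N"
    by (simp_all add: is_coefficient_def satisfies_order_upd_iff[OF \<theta> \<open>0 < N\<close>])
  then show thesis by (rule that)
qed

text \<open>Recursive choice along the natural numbers: the coefficients of index 0 and 1 are
  prescribed, and from index 2 on \<open>extend_deformation\<close> supplies the next one.\<close>

lemma deformation_with_first_order_term:
  assumes HY: "trivial_group (HY D E \<psi> 3)" and r1: "is_coefficient r1"
    and first: "satisfies_order (\<lambda>n. if n = 0 then (dprod D, dprod E, \<psi>) else if n = 1 then r1 else 0) 1"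
  obtains \<theta> where "\<And>n. is_coefficient (\<theta> n)" "\<theta> 0 = (dprod D, dprod E, \<psi>)" "\<theta> 1 = r1"
    "\<And>n. satisfies_order \<theta> n"
proof -
  \<comment> \<open>The candidate \<open>r\<close> overwrites position \<open>n\<close>, so the
    predicate depends on \<theta> only through the entries below \<open>n\<close>, as recursive
    choice requires.\<close>
  define P where "P \<theta> n r \<longleftrightarrow> is_coefficient r \<and> (n = 0 \<longrightarrow> r = (dprod D, dprod E, \<psi>)) \<and>
    (n = 1 \<longrightarrow> r = r1) \<and> satisfies_order (\<theta>(n := r)) n" for \<theta> n r
  have "\<exists>\<theta>. \<forall>n. P \<theta> n (\<theta> n)"
  proof (rule dependent_wellorder_choice)
    fix r n and \<theta> \<theta>' :: "nat \<Rightarrow> (side \<Rightarrow> 'd \<Rightarrow> 'd \<Rightarrow> 'd) \<times> (side \<Rightarrow> 'e \<Rightarrow> 'e \<Rightarrow> 'e) \<times> ('d \<Rightarrow> 'e)"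
    assume "\<And>m. m < n \<Longrightarrow> \<theta> m = \<theta>' m"
    then have "satisfies_order (\<theta>(n := r)) n = satisfies_order (\<theta>'(n := r)) n"
      by (intro satisfies_order_cong) simp
    then show "P \<theta> n r = P \<theta>' n r" by (simp add: P_def)
  next
    fix N and \<theta> :: "nat \<Rightarrow> (side \<Rightarrow> 'd \<Rightarrow> 'd \<Rightarrow> 'd) \<times> (side \<Rightarrow> 'e \<Rightarrow> 'e \<Rightarrow> 'e) \<times> ('d \<Rightarrow> 'e)"
    assume *: "\<And>m. m < N \<Longrightarrow> P \<theta> m (\<theta> m)"
    consider "N = 0" | "N = 1" | "1 < N" by linarith
    then show "\<exists>r. P \<theta> N r"
    proof cases
      case 1
      then have "P \<theta> N (dprod D, dprod E, \<psi>)"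
        by (simp add: P_def is_coefficient_def bilin_dprod lin satisfies_order_0)
      then show ?thesis ..
    next
      case 2
      have "\<theta> 0 = (dprod D, dprod E, \<psi>)" using *[of 0] 2 by (simp add: P_def)
      then have "satisfies_order (\<theta>(1 := r1)) 1"
        using first by (subst satisfies_order_cong) (auto simp: le_Suc_eq)
      then have "P \<theta> N r1" using 2 r1 by (simp add: P_def)
      then show ?thesis ..
    next
      case 3
      \<comment> \<open>Entries from \<open>N\<close> onwards are still arbitrary. Setting them to
        zero makes every entry a coefficient and gives the zero at \<open>N\<close> that
        \<open>extend_deformation\<close> expects.\<close>
      define \<theta>' where "\<theta>' n = (if n < N then \<theta> n else 0)" for n
      have c: "is_coefficient (\<theta>' n)" for n
        using *[of n] is_coefficient_0 by (simp add: \<theta>'_def P_def)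
      have z: "\<theta>' 0 = (dprod D, dprod E, \<psi>)" "\<theta>' N = 0" "0 < N"
        using *[of 0] 3 by (simp_all add: \<theta>'_def P_def)
      have o: "satisfies_order \<theta>' m" if "m < N" for m
      proof -
        \<comment> \<open>Updating \<theta> at \<open>m\<close> with its own value changes
          nothing.\<close>
        have "satisfies_order \<theta> m" using *[OF that] by (simp add: P_def)
        then show ?thesis using that by (subst satisfies_order_cong) (auto simp: \<theta>'_def)
      qed
      obtain r where r: "is_coefficient r" "satisfies_order (\<theta>'(N := r)) N"
        by (rule extend_deformation[OF HY c z o])
      have "satisfies_order (\<theta>(N := r)) N"
        using r(2) by (subst satisfies_order_cong[where \<theta>' = "\<theta>'(N := r)"]) (auto simp: \<theta>'_def)
      then have "P \<theta> N r" using r(1) 3 by (simp add: P_def)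
      then show ?thesis ..
    qed
  qed
  then obtain \<theta> where "\<And>n. P \<theta> n (\<theta> n)" by blast
  then show thesis by (intro that[of \<theta>]) (auto simp: P_def)
qed

lemma cocycle_is_infinitesimal:
  assumes HY: "trivial_group (HY D E \<psi> 3)" and "(\<xi>, \<pi>, \<phi>) \<in> ZYm D E \<psi> 2"
  shows "\<exists>\<Theta>. morphism_deformation D E \<psi> \<Theta> \<and> infinitesimal \<Theta> = (\<xi>, \<pi>, \<phi>)"
proof -
  let ?f = "\<lambda>s a b. \<xi> (tree_of s) [a, b]" and ?g = "\<lambda>s a b. \<pi> (tree_of s) [a, b]"
    and ?h = "\<lambda>a. \<phi> (Leaf \<or>\<^sub>t Leaf) [a]"
  have CY: "\<xi> \<in> CY D (self_rep D) 2" "\<pi> \<in> CY E (self_rep E) 2" "\<phi> \<in> CY D (rep_via \<psi> E) 1"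
    and d: "deltam D E \<psi> 2 (\<xi>, \<pi>, \<phi>) = 0"
    using assms(2) by (simp_all add: ZYm_def CYm_def)
  have c: "is_coefficient (?f, ?g, ?h)"
    using bilin_CY_2[OF CY(1)] bilin_CY_2[OF CY(2)] linear_CY_1[OF CY(3)]
    by (simp add: is_coefficient_def self_rep_def rep_via_def)
  let ?\<theta> = "\<lambda>n::nat. if n = 0 then (dprod D, dprod E, \<psi>) else 0"
  have "is_coefficient (dprod D, dprod E, \<psi>)"
    by (simp add: is_coefficient_def bilin_dprod lin)
  then have c0: "is_coefficient (?\<theta> n)" for n
    by (simp add: is_coefficient_0)
  \<comment> \<open>With zero at index 1, each summand of the obstruction of order 1 contains a zero
    coefficient. The equations of order 1 therefore say precisely that the inserted triple has
    coboundary zero.\<close>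
  have "satisfies_order (?\<theta>(1 := (?f, ?g, ?h))) 1"
  proof (subst satisfies_order_upd_iff)
    have "\<forall>y xs. \<psi> (\<xi> y xs) - \<pi> y (map \<psi> xs) - delta D (rep_via \<psi> E) 1 \<phi> y xs = 0"
      using d by (simp add: deltam_def zero_prod_def fun_eq_iff)
    from this[rule_format, of "tree_of _" "[_, _]"]
    have "\<psi> (?f s a b) - ?g s (\<psi> a) (\<psi> b) - delta D (rep_via \<psi> E) 1 \<phi> (tree_of s) [a, b] = 0" for s a b
      by simp
    moreover have "delta D (self_rep D) 2 \<xi> = 0" "delta E (self_rep E) 2 \<pi> = 0"
      using d by (simp_all add: deltam_def zero_prod_def)
    ultimately have "assoc_diff (dprod D) ?f y a b c = 0" "assoc_diff (dprod E) ?g y a' b' c' = 0"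
      "morphism_diff (dprod D) (dprod E) \<psi> ?f ?g ?h s a b = 0" if "y \<in> Y 3" for y a b c a' b' c' s
      using that D.delta_2_eq_assoc_diff[OF that, of \<xi> a b c] E.delta_2_eq_assoc_diff[OF that, of \<pi> a' b' c']
        third_component_eq_morphism_diff[of \<xi> s a b \<pi> \<phi>] by simp_all
    \<comment> \<open>The preceding facts, including the one on the morphism, are stated for a given
      3-tree; an explicit one is supplied to release the morphism equation, in which no tree
      occurs.\<close>
    moreover have "tree21 \<or>\<^sub>t Leaf \<in> Y 3" by (simp add: Y_3)
    ultimately show "(\<forall>y\<in>Y 3. \<forall>a b c. assoc_coeff (\<lambda>i. fst (?\<theta> i)) 1 y a b c
        + assoc_diff (dprod D) ?f y a b c = 0) \<and>
      (\<forall>y\<in>Y 3. \<forall>a b c. assoc_coeff (\<lambda>i. fst (snd (?\<theta> i))) 1 y a b c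
        + assoc_diff (dprod E) ?g y a b c = 0) \<and>
      (\<forall>s a b. morphism_coeff (\<lambda>i. fst (?\<theta> i)) (\<lambda>i. fst (snd (?\<theta> i))) (\<lambda>i. snd (snd (?\<theta> i))) 1 s a b
        + morphism_diff (dprod D) (dprod E) \<psi> ?f ?g ?h s a b = 0)"
      by (auto simp: assoc_coeff_def morphism_coeff_def dprod_zero)
  qed (use c0 in simp_all)
  then have first: "satisfies_order (\<lambda>n. if n = 0 then (dprod D, dprod E, \<psi>) else if n = 1 then (?f, ?g, ?h) else 0) 1"
    by (subst satisfies_order_cong[where \<theta>' = "?\<theta>(1 := (?f, ?g, ?h))"]) auto
  obtain \<theta> where \<theta>: "\<And>n. is_coefficient (\<theta> n)" "\<theta> 0 = (dprod D, dprod E, \<psi>)" "\<theta> 1 = (?f, ?g, ?h)"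
    "\<And>n. satisfies_order \<theta> n"
    by (rule deformation_with_first_order_term[OF HY c first]) (rule that)
  let ?\<Theta> = "((\<lambda>n. fst (\<theta> n) Lft, \<lambda>n. fst (\<theta> n) Rgt), (\<lambda>n. fst (snd (\<theta> n)) Lft, \<lambda>n. fst (snd (\<theta> n)) Rgt),
    \<lambda>n. snd (snd (\<theta> n)))"
  have "morphism_deformation D E \<psi> ?\<Theta>"
    by (rule morphism_deformationI) (use \<theta> in \<open>auto simp: is_coefficient_def satisfies_order_def\<close>)
  moreover have "infinitesimal ?\<Theta> = (\<xi>, \<pi>, \<phi>)"
    using cochain2_eq[OF CY(1)] cochain2_eq[OF CY(2)] cochain1_eq[OF CY(3)] \<theta>(3)
    by (simp add: infinitesimal_def theta_def)
  ultimately show ?thesis by blast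
qed

end

theorem corollary6p4:
  fixes D :: "('k::field, 'd::ab_group_add) dialg"
    and E :: "('k, 'e::ab_group_add) dialg"
    and \<psi> :: "'d \<Rightarrow> 'e"
  assumes "dialgebra_morphism D E \<psi>"
    and "trivial_group (HY D E \<psi> 3)"
  shows "\<forall>\<theta> \<in> ZYm D E \<psi> 2. \<exists>\<Theta>. morphism_deformation D E \<psi> \<Theta> \<and> infinitesimal \<Theta> = \<theta>"
proof
  fix \<theta> assume "\<theta> \<in> ZYm D E \<psi> 2"
  with dialgebra_morphism.cocycle_is_infinitesimal[OF assms]
  show "\<exists>\<Theta>. morphism_deformation D E \<psi> \<Theta> \<and> infinitesimal \<Theta> = \<theta>"
    by (cases \<theta>) blast
qed

end
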